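(* Let $J\subset I\subsetneq R$ be ideals of a Noetherian ring $R$. If $I/J$ contains a regular element of $R/J$, then the $R/J$-torsion of the embedded Aluffi algebra $\mathcal{A}_{R\twoheadrightarrow R/J}(I/J)$ is the kernel of the natural surjection $\mathcal{A}_{R\twoheadrightarrow R/J}(I/J)\twoheadrightarrow\mathcal{R}_{R/J}(I/J)$.
   Context: Rings are commutative with $1$. The $A$-torsion of an $A$-module $M$ is the submodule of elements annihilated by some regular element of $A$. $\mathcal{S}$ denotes the symmetric algebra and $\mathcal{R}_R(I)=\bigoplus_{t\ge 0}I^tu^t\subset R[u]$ the Rees algebra. For ideals $J\subset I\subset R$, the ($R$-embedded) Aluffi algebra of $I/J$ is $$\mathcal{A}_{R\twoheadrightarrow R/J}(I/J):=\mathcal{S}_{R/J}(I/J)\otimes_{\mathcal{S}_R(I)}\mathcal{R}_R(I)\simeq\bigoplus_{t\ge0}I^t/JI^{t-1}$$ (degree-zero part $R/J$). The natural surjection to $\mathcal{R}_{R/J}(I/J)\simeq\bigoplus_{t\ge0}I^t/(J\cap I^t)$ is the one induced by the inclusions $JI^{t-1}\subset J\cap I^t$; its kernel is $\bigoplus_{t\ge2}(J\cap I^t)/JI^{t-1}$ (the Valabrega--Valla module). *)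

theory Defs
  imports "HOL-Library.Multiset" "HOL-Algebra.Algebra"
begin

definition regular_element :: "('a, 'm) ring_scheme \<Rightarrow> 'a \<Rightarrow> bool" where
  "regular_element K a \<longleftrightarrow>
     a \<in> carrier K \<and> (\<forall>x \<in> carrier K. a \<otimes>\<^bsub>K\<^esub> x = \<zero>\<^bsub>K\<^esub> \<longrightarrow> x = \<zero>\<^bsub>K\<^esub>)"

definition torsion :: "('a, 'm) ring_scheme \<Rightarrow> ('a, 'b, 'n) module_scheme \<Rightarrow> 'b set" where
  "torsion K M =
     {x \<in> carrier M. \<exists>a. regular_element K a \<and> a \<odot>\<^bsub>M\<^esub> x = \<zero>\<^bsub>M\<^esub>}"

text \<open>An ideal of a ring, viewed as a module over that ring (the multiplicative fields of the
  record are irrelevant for a module).\<close>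

definition ideal_module :: "('a, 'm) ring_scheme \<Rightarrow> 'a set \<Rightarrow> ('a, 'a) module" where
  "ideal_module K L =
     \<lparr>carrier = L, monoid.mult = monoid.mult K, monoid.one = monoid.one K,
      ring.zero = ring.zero K, ring.add = ring.add K, smult = monoid.mult K\<rparr>"

text \<open>The image of an ideal \<open>I \<supseteq> J\<close> in \<open>R Quot J\<close>, i.e. \<open>I/J\<close>.\<close>

definition quot_ideal :: "('a, 'm) ring_scheme \<Rightarrow> 'a set \<Rightarrow> 'a set \<Rightarrow> 'a set set" where
  "quot_ideal R J I = (\<lambda>x. J +>\<^bsub>R\<^esub> x) ` I"

text \<open>The map out of a quotient ring induced by a map \<open>h\<close> on representatives
  (meaningful when \<open>h\<close> is constant on cosets).\<close>

definition quot_lift :: "('a \<Rightarrow> 'b) \<Rightarrow> 'a set \<Rightarrow> 'b" where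
  "quot_lift h Y = the_elem (h ` Y)"

text \<open>The monoid algebra \<open>K[G]\<close>: finitely supported functions with the convolution product.\<close>

definition monoid_algebra ::
  "('a, 'm) ring_scheme \<Rightarrow> ('g, 'n) monoid_scheme \<Rightarrow> ('a, 'g \<Rightarrow> 'a) module" where
  "monoid_algebra K G =
     \<lparr>carrier = {f. (\<forall>g. f g \<in> carrier K) \<and> finite {g. f g \<noteq> \<zero>\<^bsub>K\<^esub>}
                    \<and> (\<forall>g. g \<notin> carrier G \<longrightarrow> f g = \<zero>\<^bsub>K\<^esub>)},
      monoid.mult = (\<lambda>f h g. \<Oplus>\<^bsub>K\<^esub>p \<in> {(x, y). f x \<noteq> \<zero>\<^bsub>K\<^esub> \<and> h y \<noteq> \<zero>\<^bsub>K\<^esub> \<and> x \<otimes>\<^bsub>G\<^esub> y = g}.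
                         f (fst p) \<otimes>\<^bsub>K\<^esub> h (snd p)),
      monoid.one = (\<lambda>g. if g = \<one>\<^bsub>G\<^esub> then \<one>\<^bsub>K\<^esub> else \<zero>\<^bsub>K\<^esub>),
      ring.zero = (\<lambda>g. \<zero>\<^bsub>K\<^esub>),
      ring.add = (\<lambda>f h g. f g \<oplus>\<^bsub>K\<^esub> h g),
      smult = (\<lambda>a f g. a \<otimes>\<^bsub>K\<^esub> f g)\<rparr>"

definition basis_elem :: "('a, 'm) ring_scheme \<Rightarrow> 'g \<Rightarrow> 'g \<Rightarrow> 'a" where
  "basis_elem K g = (\<lambda>g'. if g' = g then \<one>\<^bsub>K\<^esub> else \<zero>\<^bsub>K\<^esub>)"

definition free_comm_monoid :: "'c set \<Rightarrow> 'c multiset monoid" where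
  "free_comm_monoid Y = \<lparr>carrier = {m. set_mset m \<subseteq> Y}, monoid.mult = (+), monoid.one = {#}\<rparr>"

text \<open>The symmetric algebra of a \<open>K\<close>-module \<open>M\<close>: the polynomial ring \<open>K[X_x | x \<in> M]\<close> (the
  monoid algebra of the free commutative monoid on \<open>M\<close>) modulo the ideal generated by
  \<open>X_(x+y) - X_x - X_y\<close> and \<open>X_(a x) - a X_x\<close>.\<close>

definition sym_poly :: "('a, 'm) ring_scheme \<Rightarrow> ('a, 'c, 'n) module_scheme
    \<Rightarrow> ('a, 'c multiset \<Rightarrow> 'a) module" where
  "sym_poly K M = monoid_algebra K (free_comm_monoid (carrier M))"

definition sym_var :: "('a, 'm) ring_scheme \<Rightarrow> 'c \<Rightarrow> 'c multiset \<Rightarrow> 'a" where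
  "sym_var K x = basis_elem K {#x#}"

definition sym_ideal :: "('a, 'm) ring_scheme \<Rightarrow> ('a, 'c, 'n) module_scheme
    \<Rightarrow> ('c multiset \<Rightarrow> 'a) set" where
  "sym_ideal K M = (let P = sym_poly K M in
     Idl\<^bsub>P\<^esub>
      ({(sym_var K (x \<oplus>\<^bsub>M\<^esub> y) \<ominus>\<^bsub>P\<^esub> sym_var K x) \<ominus>\<^bsub>P\<^esub> sym_var K y
          | x y. x \<in> carrier M \<and> y \<in> carrier M}
       \<union> {sym_var K (a \<odot>\<^bsub>M\<^esub> x) \<ominus>\<^bsub>P\<^esub> (a \<odot>\<^bsub>P\<^esub> sym_var K x)
          | a x. a \<in> carrier K \<and> x \<in> carrier M}))"

definition sym_algebra :: "('a, 'm) ring_scheme \<Rightarrow> ('a, 'c, 'n) module_scheme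
    \<Rightarrow> ('a, ('c multiset \<Rightarrow> 'a) set) module" where
  "sym_algebra K M = (let P = sym_poly K M; N = sym_ideal K M; Q = P Quot N in
     ring.extend Q (module.fields (\<lambda>a Y. (N +>\<^bsub>P\<^esub> (a \<odot>\<^bsub>P\<^esub> \<one>\<^bsub>P\<^esub>)) \<otimes>\<^bsub>Q\<^esub> Y)))"

text \<open>The canonical map \<open>M \<rightarrow> S(M)\<close>.\<close>

definition sym_gen :: "('a, 'm) ring_scheme \<Rightarrow> ('a, 'c, 'n) module_scheme
    \<Rightarrow> 'c \<Rightarrow> ('c multiset \<Rightarrow> 'a) set" where
  "sym_gen K M x = sym_ideal K M +>\<^bsub>sym_poly K M\<^esub> sym_var K x"

text \<open>The ring homomorphism \<open>S(M) \<rightarrow> B\<close> that is \<open>\<phi>\<close> on scalars and \<open>f\<close> on \<open>M\<close>, for a ring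
  homomorphism \<open>\<phi>\<close> from \<open>K\<close> to \<open>B\<close> and a \<open>\<phi>\<close>-semilinear map \<open>f\<close> from \<open>M\<close> to \<open>B\<close>.\<close>

definition sym_lift :: "('a, 'm) ring_scheme \<Rightarrow> ('b, 'n) ring_scheme
    \<Rightarrow> ('a \<Rightarrow> 'b) \<Rightarrow> ('c \<Rightarrow> 'b) \<Rightarrow> ('c multiset \<Rightarrow> 'a) set \<Rightarrow> 'b" where
  "sym_lift K B \<phi> f = quot_lift
     (\<lambda>p. \<Oplus>\<^bsub>B\<^esub>m \<in> {m. p m \<noteq> \<zero>\<^bsub>K\<^esub>}.
        \<phi> (p m) \<otimes>\<^bsub>B\<^esub> (\<Otimes>\<^bsub>B\<^esub>x \<in> set_mset m. f x [^]\<^bsub>B\<^esub> count m x))"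

text \<open>The Rees algebra, as the subring of \<open>K[u]\<close> of all polynomials whose coefficient of \<open>u^t\<close>
  lies in \<open>L^t\<close>; in particular \<open>L^0 = K\<close>.\<close>

definition rees_algebra :: "('a, 'm) ring_scheme \<Rightarrow> 'a set \<Rightarrow> ('a, nat \<Rightarrow> 'a) up_ring" where
  "rees_algebra K L =
     (UP K)\<lparr>carrier := {p \<in> carrier (UP K). \<forall>t. coeff (UP K) p t \<in> L [^]\<^bsub>ideals_set K\<^esub> t}\<rparr>"

definition sym_to_rees :: "('a, 'm) ring_scheme \<Rightarrow> 'a set
    \<Rightarrow> ('a multiset \<Rightarrow> 'a) set \<Rightarrow> nat \<Rightarrow> 'a" where
  "sym_to_rees K L =
     sym_lift K (rees_algebra K L) (\<lambda>a. monom (UP K) a 0) (\<lambda>x. monom (UP K) x 1)"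

text \<open>The tensor product \<open>B \<otimes>\<^sub>S C\<close> of two \<open>S\<close>-algebras given by ring homomorphisms
  \<open>f\<close> from \<open>S\<close> to \<open>B\<close> and \<open>g\<close> from \<open>S\<close> to \<open>C\<close>: the free abelian group on \<open>B \<times> C\<close>, with
  \<open>(b, c)(b', c') = (b b', c c')\<close>, modulo the bilinearity and \<open>S\<close>-balancedness relations.
  Multiplying a relation by a basis element \<open>(b, c)\<close> gives a relation, so the ideal generated
  by the relations is just the subgroup generated by them.\<close>

abbreviation tensor_free :: "('b, 'm) ring_scheme \<Rightarrow> ('c, 'n) ring_scheme
    \<Rightarrow> (int, 'b \<times> 'c \<Rightarrow> int) module" where
  "tensor_free B C \<equiv> monoid_algebra \<Z> (B \<times>\<times> C)"

definition tensor_ideal :: "('s, 'l) ring_scheme \<Rightarrow> ('b, 'm) ring_scheme \<Rightarrow> ('c, 'n) ring_scheme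
    \<Rightarrow> ('s \<Rightarrow> 'b) \<Rightarrow> ('s \<Rightarrow> 'c) \<Rightarrow> ('b \<times> 'c \<Rightarrow> int) set" where
  "tensor_ideal S B C f g = (let F = tensor_free B C; e = basis_elem \<Z> in
     Idl\<^bsub>F\<^esub>
      ({(e (b \<oplus>\<^bsub>B\<^esub> b', c) \<ominus>\<^bsub>F\<^esub> e (b, c)) \<ominus>\<^bsub>F\<^esub> e (b', c)
          | b b' c. b \<in> carrier B \<and> b' \<in> carrier B \<and> c \<in> carrier C}
       \<union> {(e (b, c \<oplus>\<^bsub>C\<^esub> c') \<ominus>\<^bsub>F\<^esub> e (b, c)) \<ominus>\<^bsub>F\<^esub> e (b, c')
          | b c c'. b \<in> carrier B \<and> c \<in> carrier C \<and> c' \<in> carrier C}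
       \<union> {e (b \<otimes>\<^bsub>B\<^esub> f s, c) \<ominus>\<^bsub>F\<^esub> e (b, g s \<otimes>\<^bsub>C\<^esub> c)
          | b s c. b \<in> carrier B \<and> s \<in> carrier S \<and> c \<in> carrier C}))"

definition tensor_ring :: "('s, 'l) ring_scheme \<Rightarrow> ('b, 'm) ring_scheme \<Rightarrow> ('c, 'n) ring_scheme
    \<Rightarrow> ('s \<Rightarrow> 'b) \<Rightarrow> ('s \<Rightarrow> 'c) \<Rightarrow> ('b \<times> 'c \<Rightarrow> int) set ring" where
  "tensor_ring S B C f g = tensor_free B C Quot tensor_ideal S B C f g"

definition pure_tensor :: "('s, 'l) ring_scheme \<Rightarrow> ('b, 'm) ring_scheme \<Rightarrow> ('c, 'n) ring_scheme
    \<Rightarrow> ('s \<Rightarrow> 'b) \<Rightarrow> ('s \<Rightarrow> 'c) \<Rightarrow> 'b \<Rightarrow> 'c \<Rightarrow> ('b \<times> 'c \<Rightarrow> int) set" where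
  "pure_tensor S B C f g b c = tensor_ideal S B C f g +>\<^bsub>tensor_free B C\<^esub> basis_elem \<Z> (b, c)"

text \<open>The ring homomorphism \<open>B \<otimes>\<^sub>S C \<rightarrow> D\<close>, \<open>b \<otimes> c \<mapsto> h b * k c\<close>, for ring homomorphisms
  \<open>h\<close> from \<open>B\<close> and \<open>k\<close> from \<open>C\<close> to \<open>D\<close> that agree on \<open>S\<close>.\<close>

definition tensor_lift :: "('d, 'm) ring_scheme \<Rightarrow> ('b \<Rightarrow> 'd) \<Rightarrow> ('c \<Rightarrow> 'd)
    \<Rightarrow> ('b \<times> 'c \<Rightarrow> int) set \<Rightarrow> 'd" where
  "tensor_lift D h k = quot_lift
     (\<lambda>F. \<Oplus>\<^bsub>D\<^esub>p \<in> {p. F p \<noteq> 0}. [F p] \<cdot>\<^bsub>D\<^esub> (h (fst p) \<otimes>\<^bsub>D\<^esub> k (snd p)))"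

definition sym_sub :: "('a, 'm) ring_scheme \<Rightarrow> 'a set \<Rightarrow> ('a, ('a multiset \<Rightarrow> 'a) set) module" where
  "sym_sub R I = sym_algebra R (ideal_module R I)"

definition sym_quot :: "('a, 'm) ring_scheme \<Rightarrow> 'a set \<Rightarrow> 'a set
    \<Rightarrow> ('a set, ('a set multiset \<Rightarrow> 'a set) set) module" where
  "sym_quot R J I = sym_algebra (R Quot J) (ideal_module (R Quot J) (quot_ideal R J I))"

definition rees_quot :: "('a, 'm) ring_scheme \<Rightarrow> 'a set \<Rightarrow> 'a set
    \<Rightarrow> ('a set, nat \<Rightarrow> 'a set) up_ring" where
  "rees_quot R J I = rees_algebra (R Quot J) (quot_ideal R J I)"

text \<open>The map \<open>S\<^sub>R(I) \<rightarrow> S\<^sub>R\<^sub>/\<^sub>J(I/J)\<close> induced by \<open>R \<rightarrow> R/J\<close> and \<open>I \<rightarrow> I/J\<close>.\<close>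

definition sym_sub_to_quot :: "('a, 'm) ring_scheme \<Rightarrow> 'a set \<Rightarrow> 'a set
    \<Rightarrow> ('a multiset \<Rightarrow> 'a) set \<Rightarrow> ('a set multiset \<Rightarrow> 'a set) set" where
  "sym_sub_to_quot R J I = sym_lift R (sym_quot R J I)
     (\<lambda>r. (J +>\<^bsub>R\<^esub> r) \<odot>\<^bsub>sym_quot R J I\<^esub> \<one>\<^bsub>sym_quot R J I\<^esub>)
     (\<lambda>x. sym_gen (R Quot J) (ideal_module (R Quot J) (quot_ideal R J I)) (J +>\<^bsub>R\<^esub> x))"

text \<open>The embedded Aluffi algebra \<open>S\<^sub>R\<^sub>/\<^sub>J(I/J) \<otimes> Rees\<^sub>R(I)\<close> over \<open>S\<^sub>R(I)\<close>, as an algebra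
  over \<open>R/J\<close> through the first factor.\<close>

definition aluffi_algebra :: "('a, 'm) ring_scheme \<Rightarrow> 'a set \<Rightarrow> 'a set
    \<Rightarrow> ('a set, (('a set multiset \<Rightarrow> 'a set) set \<times> (nat \<Rightarrow> 'a) \<Rightarrow> int) set) module" where
  "aluffi_algebra R J I =
     (let S = sym_sub R I; B = sym_quot R J I; C = rees_algebra R I;
          f = sym_sub_to_quot R J I; g = sym_to_rees R I;
          T = tensor_ring S B C f g
      in ring.extend T (module.fields
           (\<lambda>a Y. pure_tensor S B C f g (a \<odot>\<^bsub>B\<^esub> \<one>\<^bsub>B\<^esub>) \<one>\<^bsub>C\<^esub> \<otimes>\<^bsub>T\<^esub> Y)))"

text \<open>The natural surjection onto the Rees algebra of \<open>I/J\<close>: it is the canonical map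
  \<open>S\<^sub>R\<^sub>/\<^sub>J(I/J) \<rightarrow> Rees\<^sub>R\<^sub>/\<^sub>J(I/J)\<close> on the first factor and reduction of coefficients modulo \<open>J\<close>
  on the second. Under the isomorphism from the direct sum of the \<open>I^t/J I^(t-1)\<close> to the Aluffi
  algebra, sending the class of \<open>x \<in> I^t\<close> to \<open>1 \<otimes> x u^t\<close>, it becomes the map
  \<open>I^t/J I^(t-1) \<rightarrow> I^t/(J \<inter> I^t)\<close> in each degree.\<close>

definition aluffi_to_rees :: "('a, 'm) ring_scheme \<Rightarrow> 'a set \<Rightarrow> 'a set
    \<Rightarrow> (('a set multiset \<Rightarrow> 'a set) set \<times> (nat \<Rightarrow> 'a) \<Rightarrow> int) set \<Rightarrow> nat \<Rightarrow> 'a set" where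
  "aluffi_to_rees R J I = tensor_lift (rees_quot R J I)
     (sym_to_rees (R Quot J) (quot_ideal R J I))
     (\<lambda>p t. J +>\<^bsub>R\<^esub> p t)"

end

theory Submission
  imports Defs
begin

text \<open>
  Since \<open>S\<^sub>R(I) \<rightarrow> S\<^sub>R\<^sub>/\<^sub>J(I/J)\<close> is surjective, every element of the Aluffi algebra has the form \<open>1 \<otimes> p\<close>
  with \<open>p\<close> in the Rees algebra of \<open>I\<close>, and it lies in the kernel iff all coefficients of \<open>p\<close> are in \<open>J\<close>.
  If \<open>a \<in> I\<close> is regular modulo \<open>J\<close> and \<open>n\<close> bounds the degree of \<open>p\<close>, then \<open>a\<^sup>n\<close> kills such an element:
  \<open>a\<^sup>n p\<^sub>k u\<^sup>k = (p\<^sub>k u) (a\<^sup>n u\<^sup>k\<^sup>-\<^sup>1)\<close>, and \<open>p\<^sub>k u\<close> comes from the generator of \<open>S\<^sub>R(I)\<close> at \<open>p\<^sub>k \<in> J\<close>, which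
  vanishes in \<open>S\<^sub>R\<^sub>/\<^sub>J(I/J)\<close>. Conversely the Rees algebra of \<open>I/J\<close> consists of polynomials over \<open>R/J\<close> and so
  has no \<open>R/J\<close>-torsion; hence the torsion lies in the kernel.
\<close>

section \<open>Monoid algebras\<close>

text \<open>The direct sum of the \<open>I^t / J I^(t-1)\<close> is never identified with the Aluffi
  algebra: deciding exactly which tensors vanish would need a second construction, whereas here a
  tensor is shown to be zero by exhibiting a relation, and the kernel is read off from a map out of
  the tensor product. What has to be earned is that the raw quotients are commutative rings and that
  the maps out of them are well defined and multiplicative. Symmetric algebras and tensor products
  are both quotients of monoid algebras, over \<open>K\<close> and over the integers, so one theory
  of linear extensions from a monoid basis serves both. A single exponent handles all degrees at
  once because \<open>a^n\<close> lies in every \<open>I^m\<close> with \<open>m \<le> n\<close>,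
  and because powers of a regular element are regular. Degree zero escapes the factorization through
  \<open>u\<close>: there the constant coefficient lies in \<open>J\<close> and is already zero as a
  scalar of \<open>R/J\<close>.\<close>

lemma (in comm_monoid) finprod_group:
  assumes "finite P" and "finite T" and "h ` P \<subseteq> T" and F: "F \<in> P \<rightarrow> carrier G"
  shows "(\<Otimes>t\<in>T. \<Otimes>p\<in>{p \<in> P. h p = t}. F p) = (\<Otimes>p\<in>P. F p)"
proof -
  have "(\<Union>t\<in>T. {p \<in> P. h p = t}) = P"
    using assms(3) by auto
  moreover have "finprod G F (\<Union>t\<in>T. {p \<in> P. h p = t})
      = (\<Otimes>t\<in>T. \<Otimes>p\<in>{p \<in> P. h p = t}. F p)"
    by (rule finprod_UN_disjoint) (use assms in \<open>auto simp: pairwise_def disjnt_def\<close>)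
  ultimately show ?thesis by simp
qed

text \<open>Grouping pairs by their first component makes this an instance of
  \<open>finprod_group\<close>. Both lemmas are stated for commutative monoids so that they also
  apply to the additive monoid of a ring, that is, to \<open>finsum\<close>.\<close>

lemma (in comm_monoid) finprod_Times:
  assumes "finite A" and "finite B" and F: "\<And>x y. x \<in> A \<Longrightarrow> y \<in> B \<Longrightarrow> F x y \<in> carrier G"
  shows "(\<Otimes>x\<in>A. \<Otimes>y\<in>B. F x y) = (\<Otimes>p\<in>A \<times> B. F (fst p) (snd p))"
proof -
  have "(\<Otimes>p\<in>{p \<in> A \<times> B. fst p = x}. F (fst p) (snd p)) = (\<Otimes>y\<in>B. F x y)" if "x \<in> A" for x
  proof -
    have "{p \<in> A \<times> B. fst p = x} = Pair x ` B"
      using that by auto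
    moreover have "(\<Otimes>p\<in>Pair x ` B. F (fst p) (snd p)) = (\<Otimes>y\<in>B. F x y)"
      by (subst finprod_reindex) (use that F in \<open>auto simp: inj_on_def\<close>)
    ultimately show ?thesis by simp
  qed
  then have "(\<Otimes>x\<in>A. \<Otimes>y\<in>B. F x y)
      = (\<Otimes>x\<in>A. \<Otimes>p\<in>{p \<in> A \<times> B. fst p = x}. F (fst p) (snd p))"
    by (intro finprod_cong') (use F in auto)
  also have "\<dots> = (\<Otimes>p\<in>A \<times> B. F (fst p) (snd p))"
    by (rule finprod_group) (use assms in auto)
  finally show ?thesis .
qed

text \<open>\<open>sym_algebra\<close> extends the record of a quotient ring by a scalar
  multiplication. The two records have different types, so the ring axioms have to be transported
  field by field; \<open>ring_hom_cong\<close> and \<open>ring_hom_cong_codomain\<close> do the same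
  for homomorphisms.\<close>

lemma cring_cong:
  assumes "cring A" and "carrier B = carrier A" and "monoid.mult B = monoid.mult A"
    and "monoid.one B = monoid.one A" and "ring.zero B = ring.zero A" and "ring.add B = ring.add A"
  shows "cring B"
proof -
  interpret A: cring A by fact
  show ?thesis
  proof (intro cringI abelian_groupI comm_monoidI)
    show "\<exists>y\<in>carrier B. y \<oplus>\<^bsub>B\<^esub> x = \<zero>\<^bsub>B\<^esub>"
      if "x \<in> carrier B" for x
      using that assms A.l_neg A.a_inv_closed by metis
  qed (simp_all add: assms A.a_ac A.m_ac A.l_distr A.r_distr)
qed

lemma ring_hom_cong:
  assumes "carrier B = carrier A" and "monoid.mult B = monoid.mult A"
    and "monoid.one B = monoid.one A" and "ring.add B = ring.add A"
  shows "ring_hom B = ring_hom A"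
  by (rule ext) (simp add: ring_hom_def assms)

text \<open>This is the extension of a function \<open>\<psi>\<close> on the basis to a
  \<open>\<phi>\<close>-semilinear map on the monoid algebra. Up to the quotient,
  \<open>sym_lift\<close> and \<open>tensor_lift\<close> are maps of this kind, and so is each
  coefficient functional.\<close>

definition monoid_algebra_eval ::
  "('a, 'm) ring_scheme \<Rightarrow> ('b, 'n) ring_scheme \<Rightarrow> ('a \<Rightarrow> 'b) \<Rightarrow> ('g \<Rightarrow> 'b) \<Rightarrow> ('g \<Rightarrow> 'a) \<Rightarrow> 'b" where
  "monoid_algebra_eval K B \<phi> \<psi> f =
     (\<Oplus>\<^bsub>B\<^esub>x \<in> {x. f x \<noteq> \<zero>\<^bsub>K\<^esub>}. \<phi> (f x) \<otimes>\<^bsub>B\<^esub> \<psi> x)"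

locale comm_monoid_algebra = K: cring K + G: comm_monoid G
  for K :: "('a, 'm) ring_scheme" and G :: "('g, 'n) monoid_scheme"
begin

abbreviation A where "A \<equiv> monoid_algebra K G"

abbreviation supp where "supp f \<equiv> {x. f x \<noteq> \<zero>\<^bsub>K\<^esub>}"

lemma carrier_iff:
  "f \<in> carrier A \<longleftrightarrow> (\<forall>x. f x \<in> carrier K) \<and> finite (supp f) \<and> supp f \<subseteq> carrier G"
  by (auto simp: monoid_algebra_def)

lemma add_eq: "f \<oplus>\<^bsub>A\<^esub> h = (\<lambda>x. f x \<oplus>\<^bsub>K\<^esub> h x)"
  and zero_eq: "\<zero>\<^bsub>A\<^esub> = (\<lambda>x. \<zero>\<^bsub>K\<^esub>)"
  and one_eq: "\<one>\<^bsub>A\<^esub> = basis_elem K \<one>\<^bsub>G\<^esub>"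
  and smult_eq: "a \<odot>\<^bsub>A\<^esub> f = (\<lambda>x. a \<otimes>\<^bsub>K\<^esub> f x)"
  by (auto simp: monoid_algebra_def basis_elem_def)

lemma mult_apply:
  "(f \<otimes>\<^bsub>A\<^esub> h) x = (\<Oplus>\<^bsub>K\<^esub>p \<in> {p \<in> supp f \<times> supp h. fst p \<otimes>\<^bsub>G\<^esub> snd p = x}.
     f (fst p) \<otimes>\<^bsub>K\<^esub> h (snd p))"
proof -
  have "{(y, z). f y \<noteq> \<zero>\<^bsub>K\<^esub> \<and> h z \<noteq> \<zero>\<^bsub>K\<^esub> \<and> y \<otimes>\<^bsub>G\<^esub> z = x}
      = {p \<in> supp f \<times> supp h. fst p \<otimes>\<^bsub>G\<^esub> snd p = x}"
    by auto
  then show ?thesis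
    by (simp add: monoid_algebra_def)
qed

lemma basis_closed: "x \<in> carrier G \<Longrightarrow> basis_elem K x \<in> carrier A"
  by (auto simp: carrier_iff basis_elem_def intro: finite_subset[of _ "{x}"])

lemma zero_closed: "\<zero>\<^bsub>A\<^esub> \<in> carrier A"
  by (simp add: carrier_iff zero_eq)

lemma add_closed: "f \<in> carrier A \<Longrightarrow> h \<in> carrier A \<Longrightarrow> f \<oplus>\<^bsub>A\<^esub> h \<in> carrier A"
  unfolding carrier_iff add_eq
  by (intro conjI; force intro: finite_subset[of _ "supp f \<union> supp h"])

lemma smult_closed: "a \<in> carrier K \<Longrightarrow> f \<in> carrier A \<Longrightarrow> a \<odot>\<^bsub>A\<^esub> f \<in> carrier A"
  by (auto simp: carrier_iff smult_eq intro: finite_subset[of _ "supp f"])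

lemma mult_apply_closed:
  assumes "f \<in> carrier A" "h \<in> carrier A"
  shows "(f \<otimes>\<^bsub>A\<^esub> h) x \<in> carrier K"
  unfolding mult_apply using assms by (intro K.finsum_closed) (auto simp: carrier_iff)

lemma supp_mult:
  assumes "f \<in> carrier A" "h \<in> carrier A"
  shows "supp (f \<otimes>\<^bsub>A\<^esub> h) \<subseteq> (\<lambda>p. fst p \<otimes>\<^bsub>G\<^esub> snd p) ` (supp f \<times> supp h)"
proof
  fix x assume "x \<in> supp (f \<otimes>\<^bsub>A\<^esub> h)"
  then have "{p \<in> supp f \<times> supp h. fst p \<otimes>\<^bsub>G\<^esub> snd p = x} \<noteq> {}"
    unfolding mem_Collect_eq mult_apply by (metis (no_types, lifting) K.finsum_empty)
  then show "x \<in> (\<lambda>p. fst p \<otimes>\<^bsub>G\<^esub> snd p) ` (supp f \<times> supp h)"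
    by blast
qed

lemma mult_closed:
  assumes "f \<in> carrier A" "h \<in> carrier A"
  shows "f \<otimes>\<^bsub>A\<^esub> h \<in> carrier A"
proof -
  have "finite (supp (f \<otimes>\<^bsub>A\<^esub> h))"
    using supp_mult[OF assms] by (rule finite_subset) (use assms in \<open>auto simp: carrier_iff\<close>)
  moreover have "supp (f \<otimes>\<^bsub>A\<^esub> h) \<subseteq> carrier G"
    using supp_mult[OF assms] assms by (fastforce simp: carrier_iff)
  ultimately show ?thesis
    using mult_apply_closed[OF assms] by (simp add: carrier_iff)
qed

lemma mult_comm:
  assumes "f \<in> carrier A" "h \<in> carrier A"
  shows "f \<otimes>\<^bsub>A\<^esub> h = h \<otimes>\<^bsub>A\<^esub> f"
proof
  fix x
  let ?S = "{p \<in> supp f \<times> supp h. fst p \<otimes>\<^bsub>G\<^esub> snd p = x}"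
  have "{p \<in> supp h \<times> supp f. fst p \<otimes>\<^bsub>G\<^esub> snd p = x} = prod.swap ` ?S"
    using assms by (force simp: carrier_iff G.m_comm subset_iff)
  then have "(h \<otimes>\<^bsub>A\<^esub> f) x = (\<Oplus>\<^bsub>K\<^esub>p \<in> prod.swap ` ?S. h (fst p) \<otimes>\<^bsub>K\<^esub> f (snd p))"
    by (simp add: mult_apply)
  also have "\<dots> = (\<Oplus>\<^bsub>K\<^esub>p \<in> ?S. h (snd p) \<otimes>\<^bsub>K\<^esub> f (fst p))"
    by (subst K.finsum_reindex) (use assms in \<open>auto simp: carrier_iff\<close>)
  also have "\<dots> = (f \<otimes>\<^bsub>A\<^esub> h) x"
    unfolding mult_apply using assms
    by (intro K.finsum_cong') (auto simp: carrier_iff K.m_comm)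
  finally show "(f \<otimes>\<^bsub>A\<^esub> h) x = (h \<otimes>\<^bsub>A\<^esub> f) x" by simp
qed

end

section \<open>Semilinear extensions of functions on the monoid\<close>

locale comm_monoid_algebra_eval =
  comm_monoid_algebra K G + \<phi>: ring_hom_cring K B \<phi>
  for K :: "('a, 'm) ring_scheme" and G :: "('g, 'n) monoid_scheme"
    and B :: "('b, 'k) ring_scheme" and \<phi> :: "'a \<Rightarrow> 'b"
begin

abbreviation ev where "ev \<equiv> monoid_algebra_eval K B \<phi>"

text \<open>Points outside the support contribute nothing because \<open>\<phi>\<close> maps zero to
  zero. Elements with different supports can thus be summed over one common index set.\<close>

lemma ev_superset:
  assumes "f \<in> carrier A" "\<psi> \<in> carrier G \<rightarrow> carrier B"
    and "finite S" "supp f \<subseteq> S" "S \<subseteq> carrier G"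
  shows "ev \<psi> f = (\<Oplus>\<^bsub>B\<^esub>x \<in> S. \<phi> (f x) \<otimes>\<^bsub>B\<^esub> \<psi> x)"
  unfolding monoid_algebra_eval_def
  by (rule \<phi>.S.add.finprod_mono_neutral_cong_left[folded finsum_def])
    (use assms in \<open>auto simp: carrier_iff Pi_iff subset_iff\<close>)

lemma ev_closed:
  assumes "f \<in> carrier A" "\<psi> \<in> carrier G \<rightarrow> carrier B"
  shows "ev \<psi> f \<in> carrier B"
  unfolding monoid_algebra_eval_def using assms
  by (intro \<phi>.S.finsum_closed) (auto simp: carrier_iff subset_iff Pi_iff)

lemma ev_cong:
  assumes "f \<in> carrier A" "\<psi>' \<in> carrier G \<rightarrow> carrier B" "\<And>x. x \<in> carrier G \<Longrightarrow> \<psi> x = \<psi>' x"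
  shows "ev \<psi> f = ev \<psi>' f"
  unfolding monoid_algebra_eval_def using assms
  by (intro \<phi>.S.finsum_cong') (auto simp: carrier_iff subset_iff Pi_iff)

lemma ev_basis:
  assumes "x \<in> carrier G" "\<psi> \<in> carrier G \<rightarrow> carrier B"
  shows "ev \<psi> (basis_elem K x) = \<psi> x"
proof -
  have "ev \<psi> (basis_elem K x) = (\<Oplus>\<^bsub>B\<^esub>y \<in> {x}. \<phi> (basis_elem K x y) \<otimes>\<^bsub>B\<^esub> \<psi> y)"
    by (rule ev_superset) (use assms in \<open>auto simp: basis_closed\<close>, auto simp: basis_elem_def split: if_splits)
  then show ?thesis
    using assms by (auto simp: basis_elem_def Pi_iff)
qed

lemma ev_add:
  assumes "f \<in> carrier A" "h \<in> carrier A" "\<psi> \<in> carrier G \<rightarrow> carrier B"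
  shows "ev \<psi> (f \<oplus>\<^bsub>A\<^esub> h) = ev \<psi> f \<oplus>\<^bsub>B\<^esub> ev \<psi> h"
proof -
  let ?S = "supp f \<union> supp h"
  have S: "finite ?S" "?S \<subseteq> carrier G"
    using assms by (auto simp: carrier_iff)
  have "ev \<psi> (f \<oplus>\<^bsub>A\<^esub> h) = (\<Oplus>\<^bsub>B\<^esub>x \<in> ?S. \<phi> ((f \<oplus>\<^bsub>A\<^esub> h) x) \<otimes>\<^bsub>B\<^esub> \<psi> x)"
    by (rule ev_superset) (use assms S in \<open>auto simp: add_closed\<close>, auto simp: add_eq)
  also have "\<dots> = (\<Oplus>\<^bsub>B\<^esub>x \<in> ?S. \<phi> (f x) \<otimes>\<^bsub>B\<^esub> \<psi> x \<oplus>\<^bsub>B\<^esub> \<phi> (h x) \<otimes>\<^bsub>B\<^esub> \<psi> x)"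
    using assms S
    by (intro \<phi>.S.finsum_cong') (auto simp: carrier_iff add_eq \<phi>.S.l_distr Pi_iff)
  also have "\<dots> = (\<Oplus>\<^bsub>B\<^esub>x \<in> ?S. \<phi> (f x) \<otimes>\<^bsub>B\<^esub> \<psi> x) \<oplus>\<^bsub>B\<^esub> (\<Oplus>\<^bsub>B\<^esub>x \<in> ?S. \<phi> (h x) \<otimes>\<^bsub>B\<^esub> \<psi> x)"
    using assms S by (intro \<phi>.S.finsum_addf) (auto simp: carrier_iff Pi_iff subset_iff)
  also have "\<dots> = ev \<psi> f \<oplus>\<^bsub>B\<^esub> ev \<psi> h"
    using ev_superset[OF assms(1,3) S(1) _ S(2)] ev_superset[OF assms(2,3) S(1) _ S(2)] by simp
  finally show ?thesis .
qed

lemma ev_smult: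
  assumes "a \<in> carrier K" "f \<in> carrier A" "\<psi> \<in> carrier G \<rightarrow> carrier B"
  shows "ev \<psi> (a \<odot>\<^bsub>A\<^esub> f) = \<phi> a \<otimes>\<^bsub>B\<^esub> ev \<psi> f"
proof -
  have "ev \<psi> (a \<odot>\<^bsub>A\<^esub> f) = (\<Oplus>\<^bsub>B\<^esub>x \<in> supp f. \<phi> ((a \<odot>\<^bsub>A\<^esub> f) x) \<otimes>\<^bsub>B\<^esub> \<psi> x)"
    by (rule ev_superset) (use assms in \<open>auto simp: smult_closed\<close>, auto simp: smult_eq carrier_iff)
  also have "\<dots> = (\<Oplus>\<^bsub>B\<^esub>x \<in> supp f. \<phi> a \<otimes>\<^bsub>B\<^esub> (\<phi> (f x) \<otimes>\<^bsub>B\<^esub> \<psi> x))"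
    using assms by (intro \<phi>.S.finsum_cong') (auto simp: carrier_iff smult_eq Pi_iff subset_iff \<phi>.S.m_assoc)
  also have "\<dots> = \<phi> a \<otimes>\<^bsub>B\<^esub> ev \<psi> f"
    unfolding monoid_algebra_eval_def using assms
    by (intro \<phi>.S.finsum_rdistr[symmetric]) (auto simp: carrier_iff)
  finally show ?thesis .
qed

text \<open>Associativity of the convolution product and multiplicativity of the induced maps are both
  read off from this formula, which is why \<open>\<psi>\<close> is not assumed multiplicative.\<close>

lemma ev_mult:
  assumes f: "f \<in> carrier A" and h: "h \<in> carrier A" and \<psi>: "\<psi> \<in> carrier G \<rightarrow> carrier B"
  shows "ev \<psi> (f \<otimes>\<^bsub>A\<^esub> h) = ev (\<lambda>x. ev (\<lambda>y. \<psi> (x \<otimes>\<^bsub>G\<^esub> y)) h) f"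
proof -
  let ?P = "supp f \<times> supp h"
  let ?\<mu> = "\<lambda>p. fst p \<otimes>\<^bsub>G\<^esub> snd p"
  let ?F = "\<lambda>x y. \<phi> (f x) \<otimes>\<^bsub>B\<^esub> (\<phi> (h y) \<otimes>\<^bsub>B\<^esub> \<psi> (x \<otimes>\<^bsub>G\<^esub> y))"
  have fin: "finite (supp f)" "finite (supp h)"
    and fc: "\<And>x. f x \<in> carrier K" "\<And>x. h x \<in> carrier K"
    and sc: "\<And>x. f x \<noteq> \<zero>\<^bsub>K\<^esub> \<Longrightarrow> x \<in> carrier G" "\<And>x. h x \<noteq> \<zero>\<^bsub>K\<^esub> \<Longrightarrow> x \<in> carrier G"
    using f h by (auto simp: carrier_iff)
  have \<psi>c: "\<And>x. x \<in> carrier G \<Longrightarrow> \<psi> x \<in> carrier B"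
    using \<psi> by auto
  have "ev \<psi> (f \<otimes>\<^bsub>A\<^esub> h) = (\<Oplus>\<^bsub>B\<^esub>z \<in> ?\<mu> ` ?P. \<phi> ((f \<otimes>\<^bsub>A\<^esub> h) z) \<otimes>\<^bsub>B\<^esub> \<psi> z)"
    by (rule ev_superset[OF mult_closed[OF f h] \<psi> _ supp_mult[OF f h]]) (use fin sc in auto)
  \<comment> \<open>The coefficient of a product at \<open>z\<close> is a sum over the fibre of the
    multiplication above \<open>z\<close>; once it is expanded, the fibres reassemble to a sum over
    all pairs.\<close>
  also have "\<dots> = (\<Oplus>\<^bsub>B\<^esub>z \<in> ?\<mu> ` ?P. \<Oplus>\<^bsub>B\<^esub>p \<in> {p \<in> ?P. ?\<mu> p = z}. ?F (fst p) (snd p))"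
  proof (intro \<phi>.S.finsum_cong' refl)
    fix z assume z: "z \<in> ?\<mu> ` ?P"
    let ?S = "{p \<in> ?P. ?\<mu> p = z}"
    have zc: "\<psi> z \<in> carrier B"
      using z sc \<psi>c by auto
    have "\<phi> ((f \<otimes>\<^bsub>A\<^esub> h) z) \<otimes>\<^bsub>B\<^esub> \<psi> z
        = (\<Oplus>\<^bsub>B\<^esub>p \<in> ?S. \<phi> (f (fst p) \<otimes>\<^bsub>K\<^esub> h (snd p))) \<otimes>\<^bsub>B\<^esub> \<psi> z"
      unfolding mult_apply by (subst \<phi>.hom_finsum) (auto simp: fc o_def simp del: \<phi>.hom_mult)
    also have "\<dots> = (\<Oplus>\<^bsub>B\<^esub>p \<in> ?S. \<phi> (f (fst p) \<otimes>\<^bsub>K\<^esub> h (snd p)) \<otimes>\<^bsub>B\<^esub> \<psi> z)"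
      by (rule \<phi>.S.finsum_ldistr) (use fin fc zc in auto)
    also have "\<dots> = (\<Oplus>\<^bsub>B\<^esub>p \<in> ?S. ?F (fst p) (snd p))"
      by (intro \<phi>.S.finsum_cong') (use fc zc sc \<psi>c in \<open>auto simp: \<phi>.S.m_assoc\<close>)
    finally show "\<phi> ((f \<otimes>\<^bsub>A\<^esub> h) z) \<otimes>\<^bsub>B\<^esub> \<psi> z = (\<Oplus>\<^bsub>B\<^esub>p \<in> ?S. ?F (fst p) (snd p))" .
  qed (use fc sc \<psi>c in \<open>auto intro!: \<phi>.S.finsum_closed\<close>)
  also have "\<dots> = (\<Oplus>\<^bsub>B\<^esub>p \<in> ?P. ?F (fst p) (snd p))"
    by (rule \<phi>.S.add.finprod_group[folded finsum_def]) (use fin fc sc \<psi>c in auto)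
  also have "\<dots> = (\<Oplus>\<^bsub>B\<^esub>x \<in> supp f. \<Oplus>\<^bsub>B\<^esub>y \<in> supp h. ?F x y)"
    by (rule \<phi>.S.add.finprod_Times[folded finsum_def, symmetric]) (use fin fc sc \<psi>c in auto)
  also have "\<dots> = ev (\<lambda>x. ev (\<lambda>y. \<psi> (x \<otimes>\<^bsub>G\<^esub> y)) h) f"
    unfolding monoid_algebra_eval_def
  proof (intro \<phi>.S.finsum_cong' refl)
    fix x assume "x \<in> supp f"
    then show "(\<Oplus>\<^bsub>B\<^esub>y \<in> supp h. ?F x y)
        = \<phi> (f x) \<otimes>\<^bsub>B\<^esub> (\<Oplus>\<^bsub>B\<^esub>y \<in> supp h. \<phi> (h y) \<otimes>\<^bsub>B\<^esub> \<psi> (x \<otimes>\<^bsub>G\<^esub> y))"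
      by (intro \<phi>.S.finsum_rdistr[symmetric]) (use fin fc sc \<psi>c in auto)
  qed (use fc sc \<psi>c in \<open>auto intro!: \<phi>.S.m_closed \<phi>.S.finsum_closed\<close>)
  finally show ?thesis .
qed

end

section \<open>Ring axioms by comparison of linear functionals\<close>

context comm_monoid_algebra
begin

text \<open>Indicator functions as \<open>\<psi>\<close> yield the coefficients, so the functionals
  separate elements. Identities between convolutions can then be checked through
  \<open>ev_mult\<close>, without manipulating the sums over factorizations.\<close>

lemma eqI_ev:
  assumes "f \<in> carrier A" "h \<in> carrier A"
    and eq: "\<And>\<psi>. \<psi> \<in> carrier G \<rightarrow> carrier K
      \<Longrightarrow> monoid_algebra_eval K K id \<psi> f = monoid_algebra_eval K K id \<psi> h"
  shows "f = h"
proof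
  interpret E: comm_monoid_algebra_eval K G K id
    by unfold_locales simp
  have coeff: "monoid_algebra_eval K K id (basis_elem K x) f = f x"
    if x: "x \<in> carrier G" and f: "f \<in> carrier A" for f x
  proof -
    have "monoid_algebra_eval K K id (basis_elem K x) f
        = (\<Oplus>\<^bsub>K\<^esub>y \<in> insert x (supp f). id (f y) \<otimes>\<^bsub>K\<^esub> basis_elem K x y)"
      by (rule E.ev_superset) (use x f in \<open>auto simp: carrier_iff basis_elem_def\<close>)
    also have "\<dots> = (\<Oplus>\<^bsub>K\<^esub>y \<in> insert x (supp f). if x = y then f y else \<zero>\<^bsub>K\<^esub>)"
      by (intro K.finsum_cong') (use f in \<open>auto simp: carrier_iff basis_elem_def\<close>)
    also have "\<dots> = f x"
      by (rule K.finsum_singleton) (use f in \<open>auto simp: carrier_iff\<close>)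
    finally show ?thesis .
  qed
  fix x
  show "f x = h x"
  proof (cases "x \<in> carrier G")
    case True
    have "basis_elem K x \<in> carrier G \<rightarrow> carrier K"
      by (simp add: basis_elem_def)
    from eq[OF this] show ?thesis
      by (simp add: coeff True assms)
  next
    \<comment> \<open>Supports lie in the monoid, so both values are zero here.\<close>
    case False
    then show ?thesis
      using assms(1,2) unfolding carrier_iff by (metis (mono_tags) mem_Collect_eq subset_eq)
  qed
qed

text \<open>Under an arbitrary functional, a triple product turns into an iterated evaluation of
  \<open>\<psi>\<close> at products of three monoid elements, so associativity of \<open>A\<close>
  reduces to associativity of \<open>G\<close>. Unit law and distributivity are obtained in the same
  way; commutativity comes from swapping the pairs in \<open>mult_comm\<close>.\<close>

theorem is_cring: "cring A"
proof (intro cringI abelian_groupI comm_monoidI)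
  interpret E: comm_monoid_algebra_eval K G K id
    by unfold_locales simp
  note closed = mult_closed add_closed basis_closed
  fix f assume f: "f \<in> carrier A"
  show "\<exists>h\<in>carrier A. h \<oplus>\<^bsub>A\<^esub> f = \<zero>\<^bsub>A\<^esub>"
  proof (rule bexI)
    show "(\<lambda>x. \<ominus>\<^bsub>K\<^esub> f x) \<oplus>\<^bsub>A\<^esub> f = \<zero>\<^bsub>A\<^esub>"
      using f by (auto simp: add_eq zero_eq carrier_iff K.l_neg)
    have "supp (\<lambda>x. \<ominus>\<^bsub>K\<^esub> f x) \<subseteq> supp f"
      by auto
    then show "(\<lambda>x. \<ominus>\<^bsub>K\<^esub> f x) \<in> carrier A"
      using f unfolding carrier_iff by (auto intro: finite_subset)
  qed
  show "\<one>\<^bsub>A\<^esub> \<otimes>\<^bsub>A\<^esub> f = f"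
  proof (rule eqI_ev)
    fix \<psi> assume \<psi>: "\<psi> \<in> carrier G \<rightarrow> carrier K"
    have "E.ev \<psi> (\<one>\<^bsub>A\<^esub> \<otimes>\<^bsub>A\<^esub> f) = E.ev (\<lambda>x. E.ev (\<lambda>y. \<psi> (x \<otimes>\<^bsub>G\<^esub> y)) f) (basis_elem K \<one>\<^bsub>G\<^esub>)"
      using f \<psi> by (simp add: one_eq E.ev_mult closed)
    also have "\<dots> = E.ev (\<lambda>y. \<psi> (\<one>\<^bsub>G\<^esub> \<otimes>\<^bsub>G\<^esub> y)) f"
      by (rule E.ev_basis) (use f \<psi> in \<open>auto intro!: E.ev_closed\<close>)
    also have "\<dots> = E.ev \<psi> f"
      by (rule E.ev_cong) (use f \<psi> in auto)
    finally show "E.ev \<psi> (\<one>\<^bsub>A\<^esub> \<otimes>\<^bsub>A\<^esub> f) = E.ev \<psi> f" .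
  qed (use f in \<open>auto simp: closed one_eq\<close>)
  fix h assume h: "h \<in> carrier A"
  fix k assume k: "k \<in> carrier A"
  show "(f \<otimes>\<^bsub>A\<^esub> h) \<otimes>\<^bsub>A\<^esub> k = f \<otimes>\<^bsub>A\<^esub> (h \<otimes>\<^bsub>A\<^esub> k)"
  proof (rule eqI_ev)
    fix \<psi> assume \<psi>: "\<psi> \<in> carrier G \<rightarrow> carrier K"
    have "E.ev \<psi> ((f \<otimes>\<^bsub>A\<^esub> h) \<otimes>\<^bsub>A\<^esub> k)
        = E.ev (\<lambda>x. E.ev (\<lambda>y. E.ev (\<lambda>z. \<psi> ((x \<otimes>\<^bsub>G\<^esub> y) \<otimes>\<^bsub>G\<^esub> z)) k) h) f"
      using f h k \<psi> by (subst E.ev_mult, auto simp: closed intro!: E.ev_mult E.ev_closed)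
    also have "\<dots> = E.ev (\<lambda>x. E.ev (\<lambda>z. \<psi> (x \<otimes>\<^bsub>G\<^esub> z)) (h \<otimes>\<^bsub>A\<^esub> k)) f"
    proof (rule E.ev_cong[OF f])
      fix x assume x: "x \<in> carrier G"
      have "E.ev (\<lambda>z. \<psi> (x \<otimes>\<^bsub>G\<^esub> z)) (h \<otimes>\<^bsub>A\<^esub> k) = E.ev (\<lambda>y. E.ev (\<lambda>z. \<psi> (x \<otimes>\<^bsub>G\<^esub> (y \<otimes>\<^bsub>G\<^esub> z))) k) h"
        by (rule E.ev_mult) (use x h k \<psi> in auto)
      also have "\<dots> = E.ev (\<lambda>y. E.ev (\<lambda>z. \<psi> ((x \<otimes>\<^bsub>G\<^esub> y) \<otimes>\<^bsub>G\<^esub> z)) k) h"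
        by (intro E.ev_cong) (use x h k \<psi> in \<open>auto simp: G.m_assoc intro!: E.ev_closed E.ev_cong\<close>)
      finally show "E.ev (\<lambda>y. E.ev (\<lambda>z. \<psi> ((x \<otimes>\<^bsub>G\<^esub> y) \<otimes>\<^bsub>G\<^esub> z)) k) h
          = E.ev (\<lambda>z. \<psi> (x \<otimes>\<^bsub>G\<^esub> z)) (h \<otimes>\<^bsub>A\<^esub> k)" by simp
    qed (use h k \<psi> in \<open>auto intro!: E.ev_closed closed\<close>)
    also have "\<dots> = E.ev \<psi> (f \<otimes>\<^bsub>A\<^esub> (h \<otimes>\<^bsub>A\<^esub> k))"
      using f h k \<psi> by (simp add: E.ev_mult[of f] closed)
    finally show "E.ev \<psi> ((f \<otimes>\<^bsub>A\<^esub> h) \<otimes>\<^bsub>A\<^esub> k) = E.ev \<psi> (f \<otimes>\<^bsub>A\<^esub> (h \<otimes>\<^bsub>A\<^esub> k))" .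
  qed (use f h k in \<open>auto simp: closed\<close>)
  show "(f \<oplus>\<^bsub>A\<^esub> h) \<otimes>\<^bsub>A\<^esub> k = f \<otimes>\<^bsub>A\<^esub> k \<oplus>\<^bsub>A\<^esub> h \<otimes>\<^bsub>A\<^esub> k"
  proof (rule eqI_ev)
    fix \<psi> assume \<psi>: "\<psi> \<in> carrier G \<rightarrow> carrier K"
    have "(\<lambda>x. E.ev (\<lambda>y. \<psi> (x \<otimes>\<^bsub>G\<^esub> y)) k) \<in> carrier G \<rightarrow> carrier K"
      using k \<psi> by (auto intro!: E.ev_closed)
    then show "E.ev \<psi> ((f \<oplus>\<^bsub>A\<^esub> h) \<otimes>\<^bsub>A\<^esub> k) = E.ev \<psi> (f \<otimes>\<^bsub>A\<^esub> k \<oplus>\<^bsub>A\<^esub> h \<otimes>\<^bsub>A\<^esub> k)"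
      using f h k \<psi> by (simp add: E.ev_mult E.ev_add closed)
  qed (use f h k in \<open>auto simp: closed\<close>)
  show "f \<oplus>\<^bsub>A\<^esub> h \<oplus>\<^bsub>A\<^esub> k = f \<oplus>\<^bsub>A\<^esub> (h \<oplus>\<^bsub>A\<^esub> k)" "f \<oplus>\<^bsub>A\<^esub> h = h \<oplus>\<^bsub>A\<^esub> f"
    using f h k by (auto simp: add_eq carrier_iff K.a_ac)
  show "\<zero>\<^bsub>A\<^esub> \<oplus>\<^bsub>A\<^esub> f = f"
    using f by (auto simp: add_eq zero_eq carrier_iff)
qed (auto simp: mult_closed add_closed mult_comm zero_closed one_eq basis_closed)

lemma basis_mult:
  assumes "x \<in> carrier G" "y \<in> carrier G"
  shows "basis_elem K x \<otimes>\<^bsub>A\<^esub> basis_elem K y = basis_elem K (x \<otimes>\<^bsub>G\<^esub> y)"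
proof (rule eqI_ev)
  interpret E: comm_monoid_algebra_eval K G K id
    by unfold_locales simp
  fix \<psi> assume \<psi>: "\<psi> \<in> carrier G \<rightarrow> carrier K"
  have "(\<lambda>x. E.ev (\<lambda>z. \<psi> (x \<otimes>\<^bsub>G\<^esub> z)) (basis_elem K y)) \<in> carrier G \<rightarrow> carrier K"
    using assms \<psi> by (auto intro!: E.ev_closed basis_closed)
  moreover have "(\<lambda>z. \<psi> (x \<otimes>\<^bsub>G\<^esub> z)) \<in> carrier G \<rightarrow> carrier K"
    using assms \<psi> by auto
  ultimately show "E.ev \<psi> (basis_elem K x \<otimes>\<^bsub>A\<^esub> basis_elem K y) = E.ev \<psi> (basis_elem K (x \<otimes>\<^bsub>G\<^esub> y))"
    using assms \<psi> by (simp add: E.ev_mult basis_closed E.ev_basis)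
qed (use assms in \<open>auto simp: basis_closed mult_closed\<close>)

text \<open>Passing to a quotient ring keeps the multiplication but no scalar action. Scalars
  survive there only as multiplication by constants.\<close>

lemma smult_conv_mult:
  assumes "a \<in> carrier K" "f \<in> carrier A"
  shows "a \<odot>\<^bsub>A\<^esub> f = (a \<odot>\<^bsub>A\<^esub> \<one>\<^bsub>A\<^esub>) \<otimes>\<^bsub>A\<^esub> f"
proof (rule eqI_ev)
  interpret E: comm_monoid_algebra_eval K G K id
    by unfold_locales simp
  fix \<psi> assume \<psi>: "\<psi> \<in> carrier G \<rightarrow> carrier K"
  have *: "(\<lambda>x. E.ev (\<lambda>z. \<psi> (x \<otimes>\<^bsub>G\<^esub> z)) f) \<in> carrier G \<rightarrow> carrier K"
    using assms \<psi> by (auto intro!: E.ev_closed)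
  have "E.ev (\<lambda>z. \<psi> (\<one>\<^bsub>G\<^esub> \<otimes>\<^bsub>G\<^esub> z)) f = E.ev \<psi> f"
    by (rule E.ev_cong) (use assms \<psi> in auto)
  then show "E.ev \<psi> (a \<odot>\<^bsub>A\<^esub> f) = E.ev \<psi> ((a \<odot>\<^bsub>A\<^esub> \<one>\<^bsub>A\<^esub>) \<otimes>\<^bsub>A\<^esub> f)"
    using assms \<psi> * by (simp add: one_eq E.ev_mult basis_closed smult_closed E.ev_basis E.ev_smult)
qed (use assms in \<open>auto simp: smult_closed one_eq basis_closed mult_closed\<close>)

lemma induct [consumes 1, case_names zero add smult_basis]:
  assumes "f \<in> carrier A"
    and zero: "P \<zero>\<^bsub>A\<^esub>"
    and add: "\<And>f h. f \<in> carrier A \<Longrightarrow> h \<in> carrier A \<Longrightarrow> P f \<Longrightarrow> P h \<Longrightarrow> P (f \<oplus>\<^bsub>A\<^esub> h)"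
    and basis: "\<And>a x. a \<in> carrier K \<Longrightarrow> x \<in> carrier G \<Longrightarrow> P (a \<odot>\<^bsub>A\<^esub> basis_elem K x)"
  shows "P f"
proof -
  \<comment> \<open>The induction runs over a finite set containing the support, which loses a point
    when one coefficient is erased.\<close>
  have "P f" if "finite S" "supp f \<subseteq> S" "f \<in> carrier A" for S f
    using that
  proof (induction S arbitrary: f rule: finite_induct)
    case empty
    then have "f = \<zero>\<^bsub>A\<^esub>"
      by (auto simp: zero_eq)
    then show ?case
      using zero by simp
  next
    case (insert x S)
    define h where "h = f(x := \<zero>\<^bsub>K\<^esub>)"
    have h: "h \<in> carrier A" "supp h \<subseteq> S"
      using insert.prems by (auto simp: h_def carrier_iff elim: finite_subset[rotated])
    have fx: "f x \<in> carrier K"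
      using insert.prems by (auto simp: carrier_iff)
    show ?case
    proof (cases "x \<in> carrier G")
      case True
      have "f = h \<oplus>\<^bsub>A\<^esub> (f x \<odot>\<^bsub>A\<^esub> basis_elem K x)"
        using insert.prems by (auto simp: h_def add_eq smult_eq basis_elem_def carrier_iff)
      moreover have "P (h \<oplus>\<^bsub>A\<^esub> (f x \<odot>\<^bsub>A\<^esub> basis_elem K x))"
        using True fx h insert.IH by (intro add basis smult_closed basis_closed)
      ultimately show ?thesis by simp
    next
      \<comment> \<open>\<open>S\<close> may contain points outside the monoid; the coefficient
        there is already zero and there is no basis element to split off.\<close>
      case False
      then have "f x = \<zero>\<^bsub>K\<^esub>"
        using insert.prems unfolding carrier_iff by blast
      then have "h = f"
        by (auto simp: h_def)
      then show ?thesis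
        using insert.IH h by simp
    qed
  qed
  then show ?thesis
    using assms(1) by (auto simp: carrier_iff)
qed

end

context comm_monoid_algebra_eval
begin

text \<open>For multiplicative \<open>\<psi>\<close> the inner sum in \<open>ev_mult\<close> has the
  common factor \<open>\<psi> x\<close>; pulling it out leaves a product of two independent
  sums.\<close>

theorem ev_ring_hom:
  assumes "\<psi> \<in> carrier G \<rightarrow> carrier B" and one: "\<psi> \<one>\<^bsub>G\<^esub> = \<one>\<^bsub>B\<^esub>"
    and mult: "\<And>x y. x \<in> carrier G \<Longrightarrow> y \<in> carrier G \<Longrightarrow> \<psi> (x \<otimes>\<^bsub>G\<^esub> y) = \<psi> x \<otimes>\<^bsub>B\<^esub> \<psi> y"
  shows "ev \<psi> \<in> ring_hom A B"
proof (rule ring_hom_memI)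
  show "ev \<psi> \<one>\<^bsub>A\<^esub> = \<one>\<^bsub>B\<^esub>"
    using assms by (simp add: one_eq ev_basis)
  fix f h assume f: "f \<in> carrier A" and h: "h \<in> carrier A"
  show "ev \<psi> f \<in> carrier B"
    using f assms by (intro ev_closed)
  show "ev \<psi> (f \<oplus>\<^bsub>A\<^esub> h) = ev \<psi> f \<oplus>\<^bsub>B\<^esub> ev \<psi> h"
    using f h assms by (intro ev_add)
  have "ev (\<lambda>y. \<psi> (x \<otimes>\<^bsub>G\<^esub> y)) h = \<psi> x \<otimes>\<^bsub>B\<^esub> ev \<psi> h" if x: "x \<in> carrier G" for x
  proof -
    have "ev (\<lambda>y. \<psi> (x \<otimes>\<^bsub>G\<^esub> y)) h = (\<Oplus>\<^bsub>B\<^esub>y \<in> supp h. \<psi> x \<otimes>\<^bsub>B\<^esub> (\<phi> (h y) \<otimes>\<^bsub>B\<^esub> \<psi> y))"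
      unfolding monoid_algebra_eval_def
      by (intro \<phi>.S.finsum_cong')
        (use x h assms(1) in \<open>auto simp: mult carrier_iff Pi_iff subset_iff \<phi>.S.m_lcomm\<close>)
    also have "\<dots> = \<psi> x \<otimes>\<^bsub>B\<^esub> ev \<psi> h"
      unfolding monoid_algebra_eval_def using x h assms(1)
      by (intro \<phi>.S.finsum_rdistr[symmetric]) (auto simp: carrier_iff)
    finally show ?thesis .
  qed
  then have "ev \<psi> (f \<otimes>\<^bsub>A\<^esub> h) = ev (\<lambda>x. \<psi> x \<otimes>\<^bsub>B\<^esub> ev \<psi> h) f"
    using f h assms ev_closed[OF h assms(1)] by (auto simp: ev_mult intro!: ev_cong)
  also have "\<dots> = (\<Oplus>\<^bsub>B\<^esub>x \<in> supp f. (\<phi> (f x) \<otimes>\<^bsub>B\<^esub> \<psi> x) \<otimes>\<^bsub>B\<^esub> ev \<psi> h)"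
    unfolding monoid_algebra_eval_def[of _ _ _ _ f]
    by (intro \<phi>.S.finsum_cong')
      (use f assms(1) ev_closed[OF h assms(1)] in
        \<open>auto simp: carrier_iff Pi_iff subset_iff \<phi>.S.m_assoc\<close>)
  also have "\<dots> = ev \<psi> f \<otimes>\<^bsub>B\<^esub> ev \<psi> h"
    unfolding monoid_algebra_eval_def[of _ _ _ _ f] using f assms(1) ev_closed[OF h assms(1)]
    by (intro \<phi>.S.finsum_ldistr[symmetric]) (auto simp: carrier_iff)
  finally show "ev \<psi> (f \<otimes>\<^bsub>A\<^esub> h) = ev \<psi> f \<otimes>\<^bsub>B\<^esub> ev \<psi> h" .
qed

end

section \<open>Symmetric algebras\<close>

lemma ring_hom_cong_codomain:
  assumes "carrier B = carrier A" and "monoid.mult B = monoid.mult A"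
    and "monoid.one B = monoid.one A" and "ring.add B = ring.add A"
  shows "ring_hom P B = ring_hom P A"
  by (simp add: ring_hom_def assms)

lemma r_coset_mem_iff: "y \<in> N +>\<^bsub>P\<^esub> x \<longleftrightarrow> (\<exists>n\<in>N. y = n \<oplus>\<^bsub>P\<^esub> x)"
  by (simp add: a_r_coset_def')

lemma (in ideal) quot_coset_eq_zero: "p \<in> I \<Longrightarrow> I +> p = \<zero>\<^bsub>R Quot I\<^esub>"
  by (simp add: FactRing_def a_rcos_const)

lemma carrier_quot: "carrier (P Quot N) = (\<lambda>p. N +>\<^bsub>P\<^esub> p) ` carrier P"
  by (auto simp: FactRing_simps)

text \<open>The additivity relations of \<open>sym_ideal\<close> and \<open>tensor_ideal\<close>
  have this shape, so this turns a vanishing relation into an additivity law.\<close>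

lemma (in cring) minus_minus_eq_zeroD:
  assumes "x \<in> carrier R" "y \<in> carrier R" "z \<in> carrier R" "(z \<ominus> x) \<ominus> y = \<zero>"
  shows "z = x \<oplus> y"
proof -
  have "z = ((z \<ominus> x) \<ominus> y) \<oplus> (x \<oplus> y)"
    using assms(1-3) by algebra
  then show ?thesis
    using assms by simp
qed

text \<open>\<open>quot_lift\<close> picks the only element of the image of a coset, so everything
  rests on that image being a singleton: members of one coset differ by an element of
  \<open>N\<close>, which \<open>h\<close> sends to zero, and \<open>x\<close> itself witnesses that
  the coset is not empty.\<close>

lemma quot_lift_hom:
  assumes "ring P" "ring B" and N: "ideal N P" and h: "h \<in> ring_hom P B" and ker: "N \<subseteq> a_kernel P B h"
  shows quot_lift_coset: "x \<in> carrier P \<Longrightarrow> quot_lift h (N +>\<^bsub>P\<^esub> x) = h x"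
    and quot_lift_ring_hom: "quot_lift h \<in> ring_hom (P Quot N) B"
proof -
  interpret h: ring_hom_ring P B h
    by (intro ring_hom_ringI2 assms)
  interpret N: ideal N P by fact
  show coset: "quot_lift h (N +>\<^bsub>P\<^esub> x) = h x" if x: "x \<in> carrier P" for x
  proof -
    have "h y = h x" if y: "y \<in> N +>\<^bsub>P\<^esub> x" for y
    proof -
      obtain n where n: "n \<in> N" "y = n \<oplus>\<^bsub>P\<^esub> x"
        using y unfolding r_coset_mem_iff by (elim bexE)
      then have "n \<in> carrier P" "h n = \<zero>\<^bsub>B\<^esub>"
        using ker unfolding a_kernel_def' by blast+
      then show ?thesis
        using n x by simp
    qed
    moreover have "x \<in> N +>\<^bsub>P\<^esub> x"
      using x by (rule N.a_rcos_self)
    ultimately have "h ` (N +>\<^bsub>P\<^esub> x) = {h x}"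
      by blast
    then show ?thesis
      by (simp add: quot_lift_def)
  qed
  show "quot_lift h \<in> ring_hom (P Quot N) B"
  proof (rule ring_hom_memI)
    show "quot_lift h \<one>\<^bsub>P Quot N\<^esub> = \<one>\<^bsub>B\<^esub>"
      by (simp add: FactRing_def coset)
    fix U assume "U \<in> carrier (P Quot N)"
    then obtain x where x: "x \<in> carrier P" "U = N +>\<^bsub>P\<^esub> x"
      unfolding carrier_quot by (elim imageE)
    then show "quot_lift h U \<in> carrier B"
      by (simp add: coset)
    fix Y assume "Y \<in> carrier (P Quot N)"
    then obtain y where y: "y \<in> carrier P" "Y = N +>\<^bsub>P\<^esub> y"
      unfolding carrier_quot by (elim imageE)
    show "quot_lift h (U \<otimes>\<^bsub>P Quot N\<^esub> Y) = quot_lift h U \<otimes>\<^bsub>B\<^esub> quot_lift h Y"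
      using x y by (simp add: FactRing_def N.rcoset_mult_add coset)
    show "quot_lift h (U \<oplus>\<^bsub>P Quot N\<^esub> Y) = quot_lift h U \<oplus>\<^bsub>B\<^esub> quot_lift h Y"
      using x y by (simp add: FactRing_def N.a_rcos_sum coset)
  qed
qed

text \<open>The kernel is an ideal, so checking the generators is enough. This is how each lift is
  shown to respect its defining relations.\<close>

lemma genideal_subset_kernel:
  assumes "ring_hom_ring P B h" and "U \<subseteq> carrier P" and "\<And>x. x \<in> U \<Longrightarrow> h x = \<zero>\<^bsub>B\<^esub>"
  shows "Idl\<^bsub>P\<^esub> U \<subseteq> a_kernel P B h"
proof -
  interpret h: ring_hom_ring P B h by fact
  show ?thesis
  proof (rule h.R.genideal_minimal[OF h.kernel_is_ideal], rule subsetI)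
    fix x assume "x \<in> U"
    then show "x \<in> a_kernel P B h"
      using assms(2,3) unfolding a_kernel_def' by blast
  qed
qed

lemma comm_monoid_free_comm_monoid: "comm_monoid (free_comm_monoid Y)"
  by (rule comm_monoidI) (auto simp: free_comm_monoid_def ac_simps)

lemma free_comm_monoid_simps [simp]:
  "m \<in> carrier (free_comm_monoid Y) \<longleftrightarrow> set_mset m \<subseteq> Y"
  "monoid.mult (free_comm_monoid Y) = (+)"
  "\<one>\<^bsub>free_comm_monoid Y\<^esub> = {#}"
  by (auto simp: free_comm_monoid_def)

text \<open>The three products range over different supports. Extending all of them to the support
  of \<open>m + n\<close>, with exponent zero at the new points, reduces the claim to addition of
  exponents.\<close>

lemma (in comm_monoid) finprod_mset_union:
  assumes f: "f \<in> set_mset (m + n) \<rightarrow> carrier G"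
  shows "(\<Otimes>x\<in>set_mset (m + n). f x [^] count (m + n) x)
    = (\<Otimes>x\<in>set_mset m. f x [^] count m x) \<otimes> (\<Otimes>x\<in>set_mset n. f x [^] count n x)"
proof -
  have extend: "(\<Otimes>x\<in>set_mset k. f x [^] count k x) = (\<Otimes>x\<in>set_mset (m + n). f x [^] count k x)"
    if "set_mset k \<subseteq> set_mset (m + n)" for k
    by (rule finprod_mono_neutral_cong_left)
      (use that f in \<open>auto simp: not_in_iff\<close>)
  have "(\<Otimes>x\<in>set_mset (m + n). f x [^] count (m + n) x)
      = (\<Otimes>x\<in>set_mset (m + n). f x [^] count m x \<otimes> f x [^] count n x)"
    by (intro finprod_cong') (use f in \<open>auto simp: nat_pow_mult Pi_iff\<close>)
  also have "\<dots> = (\<Otimes>x\<in>set_mset (m + n). f x [^] count m x) \<otimes> (\<Otimes>x\<in>set_mset (m + n). f x [^] count n x)"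
    by (intro finprod_multf) (use f in auto)
  finally show ?thesis
    by (simp add: extend)
qed

locale symmetric_algebra = module K M
  for K :: "('a, 'm) ring_scheme" and M :: "('a, 'c, 'n) module_scheme"
begin

abbreviation P where "P \<equiv> sym_poly K M"
abbreviation N where "N \<equiv> sym_ideal K M"
abbreviation S where "S \<equiv> sym_algebra K M"

text \<open>The rewrite restates the facts about monoid algebras for \<open>P\<close>, the form in
  which they are used afterwards.\<close>

sublocale P: comm_monoid_algebra K "free_comm_monoid (carrier M)"
  rewrites "monoid_algebra K (free_comm_monoid (carrier M)) = P"
proof -
  show "comm_monoid_algebra K (free_comm_monoid (carrier M))"
    by (intro comm_monoid_algebra.intro comm_monoid_free_comm_monoid R.is_cring)
qed (simp add: sym_poly_def)

sublocale P: cring P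
  by (rule P.is_cring)

lemma sym_var_closed: "x \<in> carrier M \<Longrightarrow> sym_var K x \<in> carrier P"
  unfolding sym_var_def by (rule P.basis_closed) simp

lemmas P_closed = sym_var_closed P.smult_closed P.mult_closed P.add_closed P.minus_closed P.one_closed

definition relations where
  "relations = {(sym_var K (x \<oplus>\<^bsub>M\<^esub> y) \<ominus>\<^bsub>P\<^esub> sym_var K x) \<ominus>\<^bsub>P\<^esub> sym_var K y
          | x y. x \<in> carrier M \<and> y \<in> carrier M}
       \<union> {sym_var K (a \<odot>\<^bsub>M\<^esub> x) \<ominus>\<^bsub>P\<^esub> (a \<odot>\<^bsub>P\<^esub> sym_var K x)
          | a x. a \<in> carrier K \<and> x \<in> carrier M}"

lemma N_eq: "N = Idl\<^bsub>P\<^esub> relations"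
  by (simp add: sym_ideal_def relations_def Let_def)

lemma relations_closed: "relations \<subseteq> carrier P"
  unfolding relations_def by (auto intro!: P_closed)

sublocale N: ideal N P
  unfolding N_eq by (rule P.genideal_ideal[OF relations_closed])

lemma S_simps:
  "carrier S = carrier (P Quot N)"
  "monoid.mult S = monoid.mult (P Quot N)"
  "monoid.one S = monoid.one (P Quot N)"
  "ring.zero S = ring.zero (P Quot N)"
  "ring.add S = ring.add (P Quot N)"
  "a \<odot>\<^bsub>S\<^esub> Y = (N +>\<^bsub>P\<^esub> (a \<odot>\<^bsub>P\<^esub> \<one>\<^bsub>P\<^esub>)) \<otimes>\<^bsub>P Quot N\<^esub> Y"
  by (simp_all add: sym_algebra_def Let_def ring.defs module.defs)

sublocale S: cring S
  by (rule cring_cong[OF N.quotient_is_cring[OF P.is_cring]]) (simp_all add: S_simps)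

lemma coset_hom: "(\<lambda>p. N +>\<^bsub>P\<^esub> p) \<in> ring_hom P S"
  unfolding ring_hom_cong_codomain[OF S_simps(1,2,3,5)] by (rule N.rcos_ring_hom)

sublocale coset: ring_hom_cring P S "\<lambda>p. N +>\<^bsub>P\<^esub> p"
  by unfold_locales (rule coset_hom)

lemma coset_eq_zero: "p \<in> N \<Longrightarrow> N +>\<^bsub>P\<^esub> p = \<zero>\<^bsub>S\<^esub>"
  unfolding S_simps by (rule N.quot_coset_eq_zero)

lemma const_eq: "a \<in> carrier K \<Longrightarrow> a \<odot>\<^bsub>S\<^esub> \<one>\<^bsub>S\<^esub> = N +>\<^bsub>P\<^esub> (a \<odot>\<^bsub>P\<^esub> \<one>\<^bsub>P\<^esub>)"
proof -
  assume "a \<in> carrier K"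
  then have "(N +>\<^bsub>P\<^esub> (a \<odot>\<^bsub>P\<^esub> \<one>\<^bsub>P\<^esub>)) \<otimes>\<^bsub>S\<^esub> \<one>\<^bsub>S\<^esub> = N +>\<^bsub>P\<^esub> (a \<odot>\<^bsub>P\<^esub> \<one>\<^bsub>P\<^esub>)"
    by (intro S.r_one coset.hom_closed P_closed)
  then show ?thesis
    by (simp add: S_simps)
qed

lemma gen_eq: "sym_gen K M x = N +>\<^bsub>P\<^esub> sym_var K x"
  by (simp add: sym_gen_def)

lemma gen_closed: "x \<in> carrier M \<Longrightarrow> sym_gen K M x \<in> carrier S"
  unfolding gen_eq by (intro coset.hom_closed P_closed)

text \<open>The structure map of the algebra. Its multiplicativity is \<open>smult_conv_mult\<close>
  read modulo the relations.\<close>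

lemma const_hom: "(\<lambda>a. a \<odot>\<^bsub>S\<^esub> \<one>\<^bsub>S\<^esub>) \<in> ring_hom K S"
proof (rule ring_hom_memI)
  show "\<one>\<^bsub>K\<^esub> \<odot>\<^bsub>S\<^esub> \<one>\<^bsub>S\<^esub> = \<one>\<^bsub>S\<^esub>"
  proof -
    have "\<one>\<^bsub>K\<^esub> \<odot>\<^bsub>P\<^esub> \<one>\<^bsub>P\<^esub> = \<one>\<^bsub>P\<^esub>"
      using P.one_closed by (auto simp: P.smult_eq P.carrier_iff)
    then show ?thesis
      by (simp add: const_eq)
  qed
  fix a assume a: "a \<in> carrier K"
  then show "a \<odot>\<^bsub>S\<^esub> \<one>\<^bsub>S\<^esub> \<in> carrier S"
    by (simp add: const_eq P_closed)
  fix b assume b: "b \<in> carrier K"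
  have "(a \<otimes>\<^bsub>K\<^esub> b) \<odot>\<^bsub>P\<^esub> \<one>\<^bsub>P\<^esub> = a \<odot>\<^bsub>P\<^esub> (b \<odot>\<^bsub>P\<^esub> \<one>\<^bsub>P\<^esub>)"
    using a b P.one_closed by (auto simp: P.smult_eq P.carrier_iff R.m_assoc)
  also have "\<dots> = (a \<odot>\<^bsub>P\<^esub> \<one>\<^bsub>P\<^esub>) \<otimes>\<^bsub>P\<^esub> (b \<odot>\<^bsub>P\<^esub> \<one>\<^bsub>P\<^esub>)"
    using a b by (intro P.smult_conv_mult P_closed)
  finally show "(a \<otimes>\<^bsub>K\<^esub> b) \<odot>\<^bsub>S\<^esub> \<one>\<^bsub>S\<^esub> = (a \<odot>\<^bsub>S\<^esub> \<one>\<^bsub>S\<^esub>) \<otimes>\<^bsub>S\<^esub> (b \<odot>\<^bsub>S\<^esub> \<one>\<^bsub>S\<^esub>)"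
    using a b by (simp add: const_eq P_closed)
  have "(a \<oplus>\<^bsub>K\<^esub> b) \<odot>\<^bsub>P\<^esub> \<one>\<^bsub>P\<^esub> = (a \<odot>\<^bsub>P\<^esub> \<one>\<^bsub>P\<^esub>) \<oplus>\<^bsub>P\<^esub> (b \<odot>\<^bsub>P\<^esub> \<one>\<^bsub>P\<^esub>)"
    using a b P.one_closed by (auto simp: P.smult_eq P.add_eq P.carrier_iff R.l_distr)
  then show "(a \<oplus>\<^bsub>K\<^esub> b) \<odot>\<^bsub>S\<^esub> \<one>\<^bsub>S\<^esub> = (a \<odot>\<^bsub>S\<^esub> \<one>\<^bsub>S\<^esub>) \<oplus>\<^bsub>S\<^esub> (b \<odot>\<^bsub>S\<^esub> \<one>\<^bsub>S\<^esub>)"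
    using a b by (simp add: const_eq P_closed)
qed

lemma gen_add:
  assumes "x \<in> carrier M" "y \<in> carrier M"
  shows "sym_gen K M (x \<oplus>\<^bsub>M\<^esub> y) = sym_gen K M x \<oplus>\<^bsub>S\<^esub> sym_gen K M y"
proof -
  have "(sym_var K (x \<oplus>\<^bsub>M\<^esub> y) \<ominus>\<^bsub>P\<^esub> sym_var K x) \<ominus>\<^bsub>P\<^esub> sym_var K y \<in> N"
    unfolding N_eq using P.genideal_self[OF relations_closed] assms
    by (auto simp: relations_def)
  from coset_eq_zero[OF this]
  have "(sym_gen K M (x \<oplus>\<^bsub>M\<^esub> y) \<ominus>\<^bsub>S\<^esub> sym_gen K M x) \<ominus>\<^bsub>S\<^esub> sym_gen K M y = \<zero>\<^bsub>S\<^esub>"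
    using assms by (simp add: gen_eq P.minus_eq S.minus_eq P_closed)
  then show ?thesis
    using assms by (intro S.minus_minus_eq_zeroD gen_closed M.a_closed)
qed

lemma gen_smult:
  assumes "a \<in> carrier K" "x \<in> carrier M"
  shows "sym_gen K M (a \<odot>\<^bsub>M\<^esub> x) = (a \<odot>\<^bsub>S\<^esub> \<one>\<^bsub>S\<^esub>) \<otimes>\<^bsub>S\<^esub> sym_gen K M x"
proof -
  have "sym_var K (a \<odot>\<^bsub>M\<^esub> x) \<ominus>\<^bsub>P\<^esub> (a \<odot>\<^bsub>P\<^esub> sym_var K x) \<in> N"
    unfolding N_eq using P.genideal_self[OF relations_closed] assms
    by (auto simp: relations_def)
  from coset_eq_zero[OF this]
  have "sym_gen K M (a \<odot>\<^bsub>M\<^esub> x) \<ominus>\<^bsub>S\<^esub> (N +>\<^bsub>P\<^esub> (a \<odot>\<^bsub>P\<^esub> sym_var K x)) = \<zero>\<^bsub>S\<^esub>"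
    using assms by (simp add: gen_eq P.minus_eq S.minus_eq P_closed)
  then have "sym_gen K M (a \<odot>\<^bsub>M\<^esub> x) = N +>\<^bsub>P\<^esub> (a \<odot>\<^bsub>P\<^esub> sym_var K x)"
    using assms by (simp add: S.r_right_minus_eq gen_closed P_closed)
  also have "a \<odot>\<^bsub>P\<^esub> sym_var K x = (a \<odot>\<^bsub>P\<^esub> \<one>\<^bsub>P\<^esub>) \<otimes>\<^bsub>P\<^esub> sym_var K x"
    using assms by (intro P.smult_conv_mult P_closed)
  finally show ?thesis
    using assms by (simp add: const_eq gen_eq P_closed)
qed

text \<open>The basis elements of the polynomial ring are monomials, hence products of variables, so
  constants and classes of variables generate the algebra as a ring.\<close>

lemma S_induct [consumes 1, case_names const gen add mult]:
  assumes "Y \<in> carrier S"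
    and const: "\<And>a. a \<in> carrier K \<Longrightarrow> Q (a \<odot>\<^bsub>S\<^esub> \<one>\<^bsub>S\<^esub>)"
    and gen: "\<And>x. x \<in> carrier M \<Longrightarrow> Q (sym_gen K M x)"
    and add: "\<And>Y Z. Y \<in> carrier S \<Longrightarrow> Z \<in> carrier S \<Longrightarrow> Q Y \<Longrightarrow> Q Z \<Longrightarrow> Q (Y \<oplus>\<^bsub>S\<^esub> Z)"
    and mult: "\<And>Y Z. Y \<in> carrier S \<Longrightarrow> Z \<in> carrier S \<Longrightarrow> Q Y \<Longrightarrow> Q Z \<Longrightarrow> Q (Y \<otimes>\<^bsub>S\<^esub> Z)"
  shows "Q Y"
proof -
  have basis: "Q (N +>\<^bsub>P\<^esub> basis_elem K m)" if "set_mset m \<subseteq> carrier M" for m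
    using that
  proof (induction m)
    \<comment> \<open>The empty monomial is the unit, which counts as a constant.\<close>
    case empty
    have "N +>\<^bsub>P\<^esub> basis_elem K {#} = \<one>\<^bsub>K\<^esub> \<odot>\<^bsub>S\<^esub> \<one>\<^bsub>S\<^esub>"
      using ring_hom_one[OF const_hom] coset.hom_one P.one_eq by simp
    then show ?case
      using const by simp
  next
    case (add x m)
    have "basis_elem K (add_mset x m) = sym_var K x \<otimes>\<^bsub>P\<^esub> basis_elem K m"
      using add.prems by (simp add: sym_var_def P.basis_mult)
    then have "N +>\<^bsub>P\<^esub> basis_elem K (add_mset x m) = sym_gen K M x \<otimes>\<^bsub>S\<^esub> (N +>\<^bsub>P\<^esub> basis_elem K m)"
      using add.prems by (simp add: gen_eq P_closed P.basis_closed)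
    then show ?case
      using add by (simp add: mult gen gen_closed P.basis_closed)
  qed
  obtain p where p: "p \<in> carrier P" "Y = N +>\<^bsub>P\<^esub> p"
    using assms(1) unfolding S_simps carrier_quot by (elim imageE)
  from p(1) have "Q (N +>\<^bsub>P\<^esub> p)"
  proof (induction p rule: P.induct)
    case zero
    have "\<zero>\<^bsub>S\<^esub> = \<zero>\<^bsub>K\<^esub> \<odot>\<^bsub>S\<^esub> \<one>\<^bsub>S\<^esub>"
      using ring_hom_zero[OF const_hom] by (simp add: R.ring_axioms S.ring_axioms)
    then show ?case
      using const[of "\<zero>\<^bsub>K\<^esub>"] by simp
  next
    case (add f h)
    then show ?case
      by (simp add: assms(4))
  next
    case (smult_basis a m)
    then have "N +>\<^bsub>P\<^esub> (a \<odot>\<^bsub>P\<^esub> basis_elem K m) = (a \<odot>\<^bsub>S\<^esub> \<one>\<^bsub>S\<^esub>) \<otimes>\<^bsub>S\<^esub> (N +>\<^bsub>P\<^esub> basis_elem K m)"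
      by (subst P.smult_conv_mult) (simp_all add: const_eq P_closed P.basis_closed)
    then show ?case
      using smult_basis const basis
      by (simp add: mult P.basis_closed ring_hom_closed[OF const_hom])
  qed
  then show ?thesis
    using p by simp
qed

text \<open>Uniqueness half of the universal property. It later gives the commuting square over
  which the natural map is defined.\<close>

lemma ring_hom_eqI:
  assumes h: "h \<in> ring_hom S B" and k: "k \<in> ring_hom S B"
    and "\<And>a. a \<in> carrier K \<Longrightarrow> h (a \<odot>\<^bsub>S\<^esub> \<one>\<^bsub>S\<^esub>) = k (a \<odot>\<^bsub>S\<^esub> \<one>\<^bsub>S\<^esub>)"
    and "\<And>x. x \<in> carrier M \<Longrightarrow> h (sym_gen K M x) = k (sym_gen K M x)"
    and "Y \<in> carrier S"
  shows "h Y = k Y"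
  using assms(5)
  by (induction Y rule: S_induct)
    (simp_all add: assms ring_hom_add[OF h] ring_hom_add[OF k] ring_hom_mult[OF h] ring_hom_mult[OF k])

end

text \<open>Data for the existence half of the universal property. The target carries a ring
  homomorphism \<open>\<phi>\<close> instead of a \<open>K\<close>-algebra structure, which allows a
  change of scalars, as from \<open>R\<close> to \<open>R/J\<close>.\<close>

locale symmetric_algebra_lift = symmetric_algebra K M + \<phi>: ring_hom_cring K B \<phi>
  for K :: "('a, 'm) ring_scheme" and M :: "('a, 'c, 'n) module_scheme"
    and B :: "('b, 'k) ring_scheme" and \<phi> :: "'a \<Rightarrow> 'b" +
  fixes f :: "'c \<Rightarrow> 'b"
  assumes f_closed: "x \<in> carrier M \<Longrightarrow> f x \<in> carrier B"
    and f_add: "x \<in> carrier M \<Longrightarrow> y \<in> carrier M \<Longrightarrow> f (x \<oplus>\<^bsub>M\<^esub> y) = f x \<oplus>\<^bsub>B\<^esub> f y"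
    and f_smult: "a \<in> carrier K \<Longrightarrow> x \<in> carrier M \<Longrightarrow> f (a \<odot>\<^bsub>M\<^esub> x) = \<phi> a \<otimes>\<^bsub>B\<^esub> f x"
begin

definition monomial where
  "monomial m = (\<Otimes>\<^bsub>B\<^esub>x \<in> set_mset m. f x [^]\<^bsub>B\<^esub> count m x)"

sublocale E: comm_monoid_algebra_eval K "free_comm_monoid (carrier M)" B \<phi>
  rewrites "monoid_algebra K (free_comm_monoid (carrier M)) = P"
proof -
  show "comm_monoid_algebra_eval K (free_comm_monoid (carrier M)) B \<phi>"
    by (intro comm_monoid_algebra_eval.intro P.comm_monoid_algebra_axioms \<phi>.ring_hom_cring_axioms)
qed (simp add: sym_poly_def)

lemma sym_lift_eq: "sym_lift K B \<phi> f = quot_lift (E.ev monomial)"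
  unfolding sym_lift_def monoid_algebra_eval_def monomial_def by (rule refl)

lemma monomial_closed: "monomial \<in> carrier (free_comm_monoid (carrier M)) \<rightarrow> carrier B"
  by (auto simp: monomial_def f_closed subset_iff intro!: \<phi>.S.finprod_closed \<phi>.S.nat_pow_closed)

lemma monomial_single: "x \<in> carrier M \<Longrightarrow> monomial {#x#} = f x"
  by (simp add: monomial_def f_closed)

lemma ev_hom: "E.ev monomial \<in> ring_hom P B"
proof (rule E.ev_ring_hom[OF monomial_closed])
  fix m n assume "m \<in> carrier (free_comm_monoid (carrier M))" "n \<in> carrier (free_comm_monoid (carrier M))"
  then show "monomial (m \<otimes>\<^bsub>free_comm_monoid (carrier M)\<^esub> n) = monomial m \<otimes>\<^bsub>B\<^esub> monomial n"
    unfolding monomial_def free_comm_monoid_simps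
    by (intro \<phi>.S.finprod_mset_union) (auto simp: f_closed subset_iff)
qed (simp add: monomial_def)

sublocale ev: ring_hom_cring P B "E.ev monomial"
  by unfold_locales (rule ev_hom)

lemma ev_var: "x \<in> carrier M \<Longrightarrow> E.ev monomial (sym_var K x) = f x"
  by (simp add: sym_var_def E.ev_basis monomial_closed monomial_single)

text \<open>The two kinds of relations are exactly what \<open>f_add\<close> and
  \<open>f_smult\<close> kill.\<close>

lemma N_subset_kernel: "N \<subseteq> a_kernel P B (E.ev monomial)"
  unfolding N_eq
proof (rule genideal_subset_kernel[OF _ relations_closed])
  show "ring_hom_ring P B (E.ev monomial)"
    by (intro ring_hom_ringI2 ev_hom P.ring_axioms \<phi>.S.ring_axioms)
  fix p assume "p \<in> relations"
  then show "E.ev monomial p = \<zero>\<^bsub>B\<^esub>"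
    unfolding relations_def
  proof (elim UnE CollectE exE conjE)
    fix x y assume p: "p = (sym_var K (x \<oplus>\<^bsub>M\<^esub> y) \<ominus>\<^bsub>P\<^esub> sym_var K x) \<ominus>\<^bsub>P\<^esub> sym_var K y"
      and xy: "x \<in> carrier M" "y \<in> carrier M"
    then have "E.ev monomial p = ((f x \<oplus>\<^bsub>B\<^esub> f y) \<oplus>\<^bsub>B\<^esub> \<ominus>\<^bsub>B\<^esub> f x) \<oplus>\<^bsub>B\<^esub> \<ominus>\<^bsub>B\<^esub> f y"
      by (simp add: P.minus_eq P_closed ev_var f_add)
    also have "\<dots> = \<zero>\<^bsub>B\<^esub>"
      using f_closed[OF xy(1)] f_closed[OF xy(2)] by algebra
    finally show ?thesis .
  next
    fix a x assume p: "p = sym_var K (a \<odot>\<^bsub>M\<^esub> x) \<ominus>\<^bsub>P\<^esub> (a \<odot>\<^bsub>P\<^esub> sym_var K x)"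
      and ax: "a \<in> carrier K" "x \<in> carrier M"
    then have "E.ev monomial p = \<phi> a \<otimes>\<^bsub>B\<^esub> f x \<oplus>\<^bsub>B\<^esub> \<ominus>\<^bsub>B\<^esub> (\<phi> a \<otimes>\<^bsub>B\<^esub> f x)"
      by (simp add: P.minus_eq P_closed ev_var f_smult E.ev_smult monomial_closed)
    then show ?thesis
      using ax by (simp add: \<phi>.S.r_neg f_closed)
  qed
qed

lemma lift_coset: "p \<in> carrier P \<Longrightarrow> sym_lift K B \<phi> f (N +>\<^bsub>P\<^esub> p) = E.ev monomial p"
  unfolding sym_lift_eq
  by (rule quot_lift_coset[OF P.ring_axioms \<phi>.S.ring_axioms N.ideal_axioms ev_hom N_subset_kernel])

lemma lift_hom: "sym_lift K B \<phi> f \<in> ring_hom S B"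
  using quot_lift_ring_hom[OF P.ring_axioms \<phi>.S.ring_axioms N.ideal_axioms ev_hom N_subset_kernel]
  unfolding sym_lift_eq ring_hom_cong[OF S_simps(1,2,3,5)] .

lemma lift_const: "a \<in> carrier K \<Longrightarrow> sym_lift K B \<phi> f (a \<odot>\<^bsub>S\<^esub> \<one>\<^bsub>S\<^esub>) = \<phi> a"
  by (simp add: const_eq lift_coset P_closed E.ev_smult monomial_closed)

lemma lift_gen: "x \<in> carrier M \<Longrightarrow> sym_lift K B \<phi> f (sym_gen K M x) = f x"
  by (simp add: gen_eq lift_coset P_closed ev_var)

end

section \<open>Tensor products of algebras\<close>

text \<open>With this as \<open>\<phi>\<close>, maps out of the free abelian group underlying a
  tensor product become evaluations of a monoid algebra over the integers.\<close>

lemma (in ring) int_ring_hom: "(\<lambda>n::int. add_pow R n \<one>) \<in> ring_hom \<Z> R"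
proof (rule ring_hom_memI)
  fix m n :: int
  have "(add_pow R m \<one>) \<otimes> (add_pow R n \<one>) = add_pow R m (add_pow R n \<one>)"
    by (subst add_pow_ldistr_int) simp_all
  then show "add_pow R (m \<otimes>\<^bsub>\<Z>\<^esub> n) \<one> = (add_pow R m \<one>) \<otimes> (add_pow R n \<one>)"
    by (simp add: add.int_pow_pow mult.commute)
  show "add_pow R (m \<oplus>\<^bsub>\<Z>\<^esub> n) \<one> = add_pow R m \<one> \<oplus> add_pow R n \<one>"
    by (simp add: add.int_pow_mult)
qed (simp_all add: add.int_pow_1)

lemma comm_monoid_DirProd:
  assumes "comm_monoid G" "comm_monoid H"
  shows "comm_monoid (G \<times>\<times> H)"
proof -
  interpret G: comm_monoid G by fact
  interpret H: comm_monoid H by fact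
  show ?thesis
    by (rule monoid.monoid_comm_monoidI[OF DirProd_monoid[OF G.monoid_axioms H.monoid_axioms]])
      (auto simp: mult_DirProd' G.m_comm H.m_comm)
qed

locale tensor_product = B: cring B + C: cring C
  for B :: "('b, 'm) ring_scheme" and C :: "('c, 'n) ring_scheme" +
  fixes S :: "('s, 'l) ring_scheme" and f :: "'s \<Rightarrow> 'b" and g :: "'s \<Rightarrow> 'c"
  assumes f_closed: "s \<in> carrier S \<Longrightarrow> f s \<in> carrier B"
    and g_closed: "s \<in> carrier S \<Longrightarrow> g s \<in> carrier C"
begin

abbreviation F where "F \<equiv> tensor_free B C"
abbreviation N where "N \<equiv> tensor_ideal S B C f g"
abbreviation T where "T \<equiv> tensor_ring S B C f g"
abbreviation e where "e \<equiv> basis_elem \<Z>"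
abbreviation t where "t \<equiv> pure_tensor S B C f g"

sublocale F: comm_monoid_algebra \<Z> "B \<times>\<times> C"
  by (intro comm_monoid_algebra.intro comm_monoid_DirProd B.comm_monoid_axioms C.comm_monoid_axioms
      int_is_cring)

sublocale F: cring F
  by (rule F.is_cring)

lemma e_closed: "b \<in> carrier B \<Longrightarrow> c \<in> carrier C \<Longrightarrow> e (b, c) \<in> carrier F"
  by (rule F.basis_closed) simp

definition relations where
  "relations = {(e (b \<oplus>\<^bsub>B\<^esub> b', c) \<ominus>\<^bsub>F\<^esub> e (b, c)) \<ominus>\<^bsub>F\<^esub> e (b', c)
          | b b' c. b \<in> carrier B \<and> b' \<in> carrier B \<and> c \<in> carrier C}
       \<union> {(e (b, c \<oplus>\<^bsub>C\<^esub> c') \<ominus>\<^bsub>F\<^esub> e (b, c)) \<ominus>\<^bsub>F\<^esub> e (b, c')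
          | b c c'. b \<in> carrier B \<and> c \<in> carrier C \<and> c' \<in> carrier C}
       \<union> {e (b \<otimes>\<^bsub>B\<^esub> f s, c) \<ominus>\<^bsub>F\<^esub> e (b, g s \<otimes>\<^bsub>C\<^esub> c)
          | b s c. b \<in> carrier B \<and> s \<in> carrier S \<and> c \<in> carrier C}"

lemma N_eq: "N = Idl\<^bsub>F\<^esub> relations"
  by (simp add: tensor_ideal_def relations_def Let_def)

lemma relations_closed: "relations \<subseteq> carrier F"
  unfolding relations_def by (auto intro!: e_closed F.minus_closed f_closed g_closed)

sublocale N: ideal N F
  unfolding N_eq by (rule F.genideal_ideal[OF relations_closed])

sublocale T: cring T
  unfolding tensor_ring_def by (rule N.quotient_is_cring[OF F.is_cring])

sublocale coset: ring_hom_cring F T "\<lambda>p. N +>\<^bsub>F\<^esub> p"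
  by unfold_locales (simp add: tensor_ring_def N.rcos_ring_hom)

lemma coset_eq_zero: "p \<in> N \<Longrightarrow> N +>\<^bsub>F\<^esub> p = \<zero>\<^bsub>T\<^esub>"
  unfolding tensor_ring_def by (rule N.quot_coset_eq_zero)

lemma t_eq: "t b c = N +>\<^bsub>F\<^esub> e (b, c)"
  by (simp add: pure_tensor_def)

lemma t_closed: "b \<in> carrier B \<Longrightarrow> c \<in> carrier C \<Longrightarrow> t b c \<in> carrier T"
  by (simp add: t_eq e_closed)

lemma t_mult:
  assumes "b \<in> carrier B" "b' \<in> carrier B" "c \<in> carrier C" "c' \<in> carrier C"
  shows "t b c \<otimes>\<^bsub>T\<^esub> t b' c' = t (b \<otimes>\<^bsub>B\<^esub> b') (c \<otimes>\<^bsub>C\<^esub> c')"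
  using assms by (simp add: t_eq e_closed F.basis_mult flip: coset.hom_mult)

lemma relation_in_N: "p \<in> relations \<Longrightarrow> p \<in> N"
  unfolding N_eq using F.genideal_self[OF relations_closed] by auto

lemma t_add_left:
  assumes "b \<in> carrier B" "b' \<in> carrier B" "c \<in> carrier C"
  shows "t (b \<oplus>\<^bsub>B\<^esub> b') c = t b c \<oplus>\<^bsub>T\<^esub> t b' c"
proof -
  have "(e (b \<oplus>\<^bsub>B\<^esub> b', c) \<ominus>\<^bsub>F\<^esub> e (b, c)) \<ominus>\<^bsub>F\<^esub> e (b', c) \<in> N"
    by (rule relation_in_N) (use assms in \<open>auto simp: relations_def\<close>)
  from coset_eq_zero[OF this]
  have "(t (b \<oplus>\<^bsub>B\<^esub> b') c \<ominus>\<^bsub>T\<^esub> t b c) \<ominus>\<^bsub>T\<^esub> t b' c = \<zero>\<^bsub>T\<^esub>"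
    using assms by (simp add: t_eq e_closed F.minus_eq T.minus_eq)
  then show ?thesis
    using assms by (intro T.minus_minus_eq_zeroD t_closed B.a_closed)
qed

lemma t_add_right:
  assumes "b \<in> carrier B" "c \<in> carrier C" "c' \<in> carrier C"
  shows "t b (c \<oplus>\<^bsub>C\<^esub> c') = t b c \<oplus>\<^bsub>T\<^esub> t b c'"
proof -
  have "(e (b, c \<oplus>\<^bsub>C\<^esub> c') \<ominus>\<^bsub>F\<^esub> e (b, c)) \<ominus>\<^bsub>F\<^esub> e (b, c') \<in> N"
    by (rule relation_in_N) (use assms in \<open>auto simp: relations_def\<close>)
  from coset_eq_zero[OF this]
  have "(t b (c \<oplus>\<^bsub>C\<^esub> c') \<ominus>\<^bsub>T\<^esub> t b c) \<ominus>\<^bsub>T\<^esub> t b c' = \<zero>\<^bsub>T\<^esub>"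
    using assms by (simp add: t_eq e_closed F.minus_eq T.minus_eq)
  then show ?thesis
    using assms by (intro T.minus_minus_eq_zeroD t_closed C.a_closed)
qed

lemma t_balanced:
  assumes "b \<in> carrier B" "s \<in> carrier S" "c \<in> carrier C"
  shows "t (b \<otimes>\<^bsub>B\<^esub> f s) c = t b (g s \<otimes>\<^bsub>C\<^esub> c)"
proof -
  have "e (b \<otimes>\<^bsub>B\<^esub> f s, c) \<ominus>\<^bsub>F\<^esub> e (b, g s \<otimes>\<^bsub>C\<^esub> c) \<in> N"
    by (rule relation_in_N) (use assms in \<open>auto simp: relations_def\<close>)
  from coset_eq_zero[OF this]
  have "t (b \<otimes>\<^bsub>B\<^esub> f s) c \<ominus>\<^bsub>T\<^esub> t b (g s \<otimes>\<^bsub>C\<^esub> c) = \<zero>\<^bsub>T\<^esub>"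
    using assms by (simp add: t_eq e_closed F.minus_eq T.minus_eq f_closed g_closed)
  then show ?thesis
    using assms by (simp add: T.r_right_minus_eq t_closed f_closed g_closed)
qed

lemma t_zero_left: "c \<in> carrier C \<Longrightarrow> t \<zero>\<^bsub>B\<^esub> c = \<zero>\<^bsub>T\<^esub>"
  using t_add_left[of "\<zero>\<^bsub>B\<^esub>" "\<zero>\<^bsub>B\<^esub>" c] t_closed[of "\<zero>\<^bsub>B\<^esub>" c]
  by (metis B.zero_closed B.r_zero T.add.r_cancel_one')

lemma t_zero_right: "b \<in> carrier B \<Longrightarrow> t b \<zero>\<^bsub>C\<^esub> = \<zero>\<^bsub>T\<^esub>"
  using t_add_right[of b "\<zero>\<^bsub>C\<^esub>" "\<zero>\<^bsub>C\<^esub>"] t_closed[of b "\<zero>\<^bsub>C\<^esub>"]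
  by (metis C.zero_closed C.r_zero T.add.r_cancel_one')

lemma t_minus_right:
  assumes "b \<in> carrier B" "c \<in> carrier C"
  shows "t b (\<ominus>\<^bsub>C\<^esub> c) = \<ominus>\<^bsub>T\<^esub> t b c"
proof -
  have "t b (\<ominus>\<^bsub>C\<^esub> c) \<oplus>\<^bsub>T\<^esub> t b c = \<zero>\<^bsub>T\<^esub>"
    using assms by (simp add: C.l_neg t_zero_right flip: t_add_right)
  then show ?thesis
    using assms by (intro T.minus_equality[symmetric]) (auto simp: t_closed)
qed

text \<open>Pure tensors generate the tensor product as an additive group. Coefficients are
  integers, hence the clause for negatives; zero is covered because it is the pure tensor of two
  zeros.\<close>

lemma T_induct [consumes 1, case_names pure add minus]:
  assumes "Y \<in> carrier T"
    and pure: "\<And>b c. b \<in> carrier B \<Longrightarrow> c \<in> carrier C \<Longrightarrow> Q (t b c)"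
    and add: "\<And>Y Z. Y \<in> carrier T \<Longrightarrow> Z \<in> carrier T \<Longrightarrow> Q Y \<Longrightarrow> Q Z \<Longrightarrow> Q (Y \<oplus>\<^bsub>T\<^esub> Z)"
    and minus: "\<And>Y. Y \<in> carrier T \<Longrightarrow> Q Y \<Longrightarrow> Q (\<ominus>\<^bsub>T\<^esub> Y)"
  shows "Q Y"
proof -
  obtain p where p: "p \<in> carrier F" "Y = N +>\<^bsub>F\<^esub> p"
    using assms(1) unfolding tensor_ring_def carrier_quot by (elim imageE)
  have zero: "Q \<zero>\<^bsub>T\<^esub>"
    using pure[of "\<zero>\<^bsub>B\<^esub>" "\<zero>\<^bsub>C\<^esub>"] by (simp add: t_zero_left)
  from p(1) have "Q (N +>\<^bsub>F\<^esub> p)"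
  proof (induction p rule: F.induct)
    case zero
    then show ?case
      using \<open>Q \<zero>\<^bsub>T\<^esub>\<close> by simp
  next
    case (add p q)
    then show ?case
      by (simp add: assms(3))
  next
    case (smult_basis n x)
    obtain b c where x: "x = (b, c)" "b \<in> carrier B" "c \<in> carrier C"
      using smult_basis by auto
    \<comment> \<open>Changing an integer coefficient by one in either direction, as needed for the
      induction over the integers from zero.\<close>
    have step: "m \<odot>\<^bsub>F\<^esub> e x \<in> carrier F" "(m + 1) \<odot>\<^bsub>F\<^esub> e x = m \<odot>\<^bsub>F\<^esub> e x \<oplus>\<^bsub>F\<^esub> e x"
      "(m - 1) \<odot>\<^bsub>F\<^esub> e x = m \<odot>\<^bsub>F\<^esub> e x \<oplus>\<^bsub>F\<^esub> \<ominus>\<^bsub>F\<^esub> e x" for m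
    proof -
      show "m \<odot>\<^bsub>F\<^esub> e x \<in> carrier F"
        using x by (simp add: F.smult_closed e_closed)
      show plus: "(m + 1) \<odot>\<^bsub>F\<^esub> e x = m \<odot>\<^bsub>F\<^esub> e x \<oplus>\<^bsub>F\<^esub> e x" for m
        by (auto simp: F.smult_eq F.add_eq algebra_simps)
      have "m \<odot>\<^bsub>F\<^esub> e x = (m - 1) \<odot>\<^bsub>F\<^esub> e x \<oplus>\<^bsub>F\<^esub> e x"
        using plus[of "m - 1"] by simp
      then show "(m - 1) \<odot>\<^bsub>F\<^esub> e x = m \<odot>\<^bsub>F\<^esub> e x \<oplus>\<^bsub>F\<^esub> \<ominus>\<^bsub>F\<^esub> e x"
        using x by (simp add: F.smult_closed e_closed F.a_assoc F.r_neg)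
    qed
    have e: "e x \<in> carrier F" "Q (N +>\<^bsub>F\<^esub> e x)"
      using x pure by (auto simp: e_closed t_eq)
    show ?case
    proof (induction n rule: int_induct[where k = 0])
      case base
      have "0 \<odot>\<^bsub>F\<^esub> e x = \<zero>\<^bsub>F\<^esub>"
        by (simp add: F.smult_eq F.zero_eq)
      then show ?case
        using zero by simp
    next
      case (step1 i)
      then show ?case
        using e step(1) by (simp add: step(2) add)
    next
      case (step2 i)
      then show ?case
        using e step(1) by (simp add: step(3) add minus)
    qed
  qed
  then show ?thesis
    using p by simp
qed

end

text \<open>The assumption \<open>agree\<close> is the commuting square over \<open>S\<close>; it is
  what makes the balancing relations vanish in \<open>D\<close>.\<close>

locale tensor_product_lift = tensor_product B C S f g + D: cring D
  for B :: "('b, 'm) ring_scheme" and C :: "('c, 'n) ring_scheme"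
    and S :: "('s, 'l) ring_scheme" and f :: "'s \<Rightarrow> 'b" and g :: "'s \<Rightarrow> 'c"
    and D :: "('d, 'k) ring_scheme" +
  fixes h :: "'b \<Rightarrow> 'd" and k :: "'c \<Rightarrow> 'd"
  assumes h: "h \<in> ring_hom B D" and k: "k \<in> ring_hom C D"
    and agree: "s \<in> carrier S \<Longrightarrow> h (f s) = k (g s)"
begin

sublocale h: ring_hom_cring B D h
  by unfold_locales (rule h)

sublocale k: ring_hom_cring C D k
  by unfold_locales (rule k)

abbreviation \<psi> where "\<psi> \<equiv> \<lambda>p. h (fst p) \<otimes>\<^bsub>D\<^esub> k (snd p)"

sublocale E: comm_monoid_algebra_eval \<Z> "B \<times>\<times> C" D "\<lambda>n. add_pow D n \<one>\<^bsub>D\<^esub>"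
  by unfold_locales (rule D.int_ring_hom)

lemma \<psi>_closed: "\<psi> \<in> carrier (B \<times>\<times> C) \<rightarrow> carrier D"
  by auto

lemma ev_hom: "E.ev \<psi> \<in> ring_hom F D"
  by (rule E.ev_ring_hom[OF \<psi>_closed]) (auto simp: mult_DirProd' D.m_ac)

sublocale ev: ring_hom_cring F D "E.ev \<psi>"
  by unfold_locales (rule ev_hom)

lemma ev_e: "b \<in> carrier B \<Longrightarrow> c \<in> carrier C \<Longrightarrow> E.ev \<psi> (e (b, c)) = h b \<otimes>\<^bsub>D\<^esub> k c"
  using E.ev_basis[OF _ \<psi>_closed, of "(b, c)"] by simp

lemma N_subset_kernel: "N \<subseteq> a_kernel F D (E.ev \<psi>)"
  unfolding N_eq
proof (rule genideal_subset_kernel[OF _ relations_closed])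
  show "ring_hom_ring F D (E.ev \<psi>)"
    by (intro ring_hom_ringI2 ev_hom F.ring_axioms D.ring_axioms)
  fix p assume "p \<in> relations"
  then show "E.ev \<psi> p = \<zero>\<^bsub>D\<^esub>"
    unfolding relations_def
  proof (elim UnE CollectE exE conjE)
    fix b b' c assume p: "p = (e (b \<oplus>\<^bsub>B\<^esub> b', c) \<ominus>\<^bsub>F\<^esub> e (b, c)) \<ominus>\<^bsub>F\<^esub> e (b', c)"
      and c: "b \<in> carrier B" "b' \<in> carrier B" "c \<in> carrier C"
    then have "E.ev \<psi> p = ((h b \<oplus>\<^bsub>D\<^esub> h b') \<otimes>\<^bsub>D\<^esub> k c \<oplus>\<^bsub>D\<^esub> \<ominus>\<^bsub>D\<^esub> (h b \<otimes>\<^bsub>D\<^esub> k c))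
        \<oplus>\<^bsub>D\<^esub> \<ominus>\<^bsub>D\<^esub> (h b' \<otimes>\<^bsub>D\<^esub> k c)"
      by (simp add: F.minus_eq e_closed ev_e)
    also have "\<dots> = \<zero>\<^bsub>D\<^esub>"
      using h.hom_closed[OF c(1)] h.hom_closed[OF c(2)] k.hom_closed[OF c(3)] by algebra
    finally show ?thesis .
  next
    fix b c c' assume p: "p = (e (b, c \<oplus>\<^bsub>C\<^esub> c') \<ominus>\<^bsub>F\<^esub> e (b, c)) \<ominus>\<^bsub>F\<^esub> e (b, c')"
      and c: "b \<in> carrier B" "c \<in> carrier C" "c' \<in> carrier C"
    then have "E.ev \<psi> p = (h b \<otimes>\<^bsub>D\<^esub> (k c \<oplus>\<^bsub>D\<^esub> k c') \<oplus>\<^bsub>D\<^esub> \<ominus>\<^bsub>D\<^esub> (h b \<otimes>\<^bsub>D\<^esub> k c))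
        \<oplus>\<^bsub>D\<^esub> \<ominus>\<^bsub>D\<^esub> (h b \<otimes>\<^bsub>D\<^esub> k c')"
      by (simp add: F.minus_eq e_closed ev_e)
    also have "\<dots> = \<zero>\<^bsub>D\<^esub>"
      using h.hom_closed[OF c(1)] k.hom_closed[OF c(2)] k.hom_closed[OF c(3)] by algebra
    finally show ?thesis .
  next
    fix b s c assume p: "p = e (b \<otimes>\<^bsub>B\<^esub> f s, c) \<ominus>\<^bsub>F\<^esub> e (b, g s \<otimes>\<^bsub>C\<^esub> c)"
      and c: "b \<in> carrier B" "s \<in> carrier S" "c \<in> carrier C"
    then have "E.ev \<psi> p
        = (h b \<otimes>\<^bsub>D\<^esub> h (f s)) \<otimes>\<^bsub>D\<^esub> k c \<oplus>\<^bsub>D\<^esub> \<ominus>\<^bsub>D\<^esub> (h b \<otimes>\<^bsub>D\<^esub> (k (g s) \<otimes>\<^bsub>D\<^esub> k c))"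
      by (simp add: F.minus_eq e_closed ev_e f_closed g_closed)
    then show ?thesis
      using c by (simp add: agree D.m_assoc D.r_neg f_closed g_closed)
  qed
qed

text \<open>\<open>tensor_lift\<close> takes integer multiples of the products of the images,
  whereas the evaluation multiplies by the image of the integer in \<open>D\<close>. The two
  formulas agree on the carrier of \<open>F\<close>, and everything proved about the evaluation is
  carried over along this agreement.\<close>

lemma lift_coset: "p \<in> carrier F \<Longrightarrow> tensor_lift D h k (N +>\<^bsub>F\<^esub> p) = E.ev \<psi> p"
  and lift_hom: "tensor_lift D h k \<in> ring_hom T D"
proof -
  let ?h = "\<lambda>F. \<Oplus>\<^bsub>D\<^esub>p \<in> {p. F p \<noteq> 0}. add_pow D (F p) (h (fst p) \<otimes>\<^bsub>D\<^esub> k (snd p))"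
  have eq: "?h p = E.ev \<psi> p" if "p \<in> carrier F" for p
    unfolding monoid_algebra_eval_def using that
    by (intro D.finsum_cong')
      (auto simp: F.carrier_iff D.add_pow_ldistr_int subset_iff)
  \<comment> \<open>Agreement on the carrier suffices, since \<open>ring_hom\<close> constrains
    values only there.\<close>
  have hom: "?h \<in> ring_hom F D"
    using ev_hom unfolding ring_hom_def by (auto simp: eq Pi_iff)
  have ker: "N \<subseteq> a_kernel F D ?h"
  proof
    fix p assume p: "p \<in> N"
    have "p \<in> a_kernel F D (E.ev \<psi>)"
      using N_subset_kernel p by (rule subsetD)
    then have F: "p \<in> carrier F" and "E.ev \<psi> p = \<zero>\<^bsub>D\<^esub>"
      unfolding a_kernel_def' by blast+
    then have "?h p = \<zero>\<^bsub>D\<^esub>"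
      by (simp only: eq[OF F])
    with F show "p \<in> a_kernel F D ?h"
      unfolding a_kernel_def' by blast
  qed
  note lift = quot_lift_hom[OF F.ring_axioms D.ring_axioms N.ideal_axioms hom ker]
  show "tensor_lift D h k (N +>\<^bsub>F\<^esub> p) = E.ev \<psi> p" if p: "p \<in> carrier F"
    unfolding tensor_lift_def lift(1)[OF p] by (rule eq[OF p])
  show "tensor_lift D h k \<in> ring_hom T D"
    unfolding tensor_lift_def tensor_ring_def by (rule lift(2))
qed

lemma lift_pure: "b \<in> carrier B \<Longrightarrow> c \<in> carrier C \<Longrightarrow> tensor_lift D h k (t b c) = h b \<otimes>\<^bsub>D\<^esub> k c"
  by (simp add: t_eq lift_coset e_closed ev_e)

end

section \<open>Rees algebras\<close>

lemma ideal_module_simps [simp]: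
  "carrier (ideal_module K L) = L"
  "monoid.mult (ideal_module K L) = monoid.mult K"
  "\<one>\<^bsub>ideal_module K L\<^esub> = \<one>\<^bsub>K\<^esub>"
  "\<zero>\<^bsub>ideal_module K L\<^esub> = \<zero>\<^bsub>K\<^esub>"
  "ring.add (ideal_module K L) = ring.add K"
  "smult (ideal_module K L) = monoid.mult K"
  by (simp_all add: ideal_module_def)

locale rees = K: cring K + L: ideal L K
  for K :: "('a, 'm) ring_scheme" and L :: "'a set"
begin

abbreviation Lp where "Lp n \<equiv> L [^]\<^bsub>ideals_set K\<^esub> (n::nat)"
abbreviation C where "C \<equiv> rees_algebra K L"
abbreviation U where "U \<equiv> UP K"

section \<open>Powers of an ideal\<close>

lemma module_ideal_module: "module K (ideal_module K L)"
proof (intro moduleI abelian_groupI)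
  fix x assume "x \<in> carrier (ideal_module K L)"
  then show "\<exists>y\<in>carrier (ideal_module K L). y \<oplus>\<^bsub>ideal_module K L\<^esub> x = \<zero>\<^bsub>ideal_module K L\<^esub>"
    by (intro bexI[of _ "\<ominus>\<^bsub>K\<^esub> x"]) (auto simp: K.l_neg L.a_Hcarr L.a_inv_closed)
qed (auto simp: L.a_Hcarr L.I_l_closed K.cring_axioms K.l_distr K.r_distr K.m_assoc K.a_ac)

text \<open>Powers are taken in the commutative monoid of ideals, so they stay among ideals and
  their zeroth power is the whole ring.\<close>

lemma power_ideal: "ideal (Lp n) K"
proof -
  interpret I: comm_monoid "ideals_set K"
    by (rule K.ideals_set_is_comm_monoid)
  have "Lp n \<in> carrier (ideals_set K)"
    by (rule I.nat_pow_closed) (simp add: ideals_set_def L.ideal_axioms)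
  then show ?thesis
    by (simp add: ideals_set_def)
qed

lemma ideals_set_simps:
  "\<one>\<^bsub>ideals_set K\<^esub> = carrier K" "monoid.mult (ideals_set K) = ideal_prod K"
  by (simp_all add: ideals_set_def)

lemma power_0: "Lp 0 = carrier K"
  and power_Suc: "Lp (Suc n) = ideal_prod K (Lp n) L"
  by (simp_all add: ideals_set_simps)

lemma power_mult:
  assumes "x \<in> Lp i" "y \<in> Lp j"
  shows "x \<otimes>\<^bsub>K\<^esub> y \<in> Lp (i + j)"
proof -
  interpret I: comm_monoid "ideals_set K"
    by (rule K.ideals_set_is_comm_monoid)
  have "Lp i \<otimes>\<^bsub>ideals_set K\<^esub> Lp j = Lp (i + j)"
    by (rule I.nat_pow_mult) (simp add: ideals_set_def L.ideal_axioms)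
  with ideal_prod.prod[OF assms, of K] show ?thesis
    by (simp add: ideals_set_simps)
qed

lemma power_1: "Lp (Suc 0) = L"
  unfolding power_Suc power_0
  by (metis K.ideal_prod_commute K.ideal_prod_one K.oneideal L.ideal_axioms)

text \<open>A product of ideals is contained in their intersection. This puts \<open>a^n\<close>
  into all lower powers of the ideal.\<close>

lemma power_antimono: "m \<le> n \<Longrightarrow> Lp n \<subseteq> Lp m"
proof (induction n)
  case (Suc n)
  have "Lp (Suc n) \<subseteq> Lp n"
    unfolding power_Suc using K.ideal_prod_inter[OF power_ideal L.ideal_axioms, of n] by blast
  then show ?case
    using Suc by (auto simp only: le_Suc_eq)
qed simp

lemma pow_in_power: "a \<in> L \<Longrightarrow> a [^]\<^bsub>K\<^esub> n \<in> Lp n"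
  by (induction n) (simp_all add: ideals_set_simps ideal_prod.prod)

lemma power_carrier: "x \<in> Lp n \<Longrightarrow> x \<in> carrier K"
  by (rule ideal.Icarr[OF power_ideal])

lemma monom_apply: "a \<in> carrier K \<Longrightarrow> monom U a n = (\<lambda>i. if i = n then a else \<zero>\<^bsub>K\<^esub>)"
  by (simp add: UP_def)

lemma carrier_iff: "p \<in> carrier C \<longleftrightarrow> p \<in> up K \<and> (\<forall>n. p n \<in> Lp n)"
  by (auto simp: rees_algebra_def UP_def)

lemma carrier_iff_coeff: "p \<in> carrier C \<longleftrightarrow> p \<in> carrier U \<and> (\<forall>n. coeff U p n \<in> Lp n)"
  by (simp add: rees_algebra_def)

lemma coeff_eq: "p \<in> up K \<Longrightarrow> coeff U p n = p n"
  and carrier_U: "carrier U = up K"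
  by (simp_all add: UP_def)

lemma power_zero: "\<zero>\<^bsub>K\<^esub> \<in> Lp n"
  by (rule additive_subgroup.zero_closed[OF ideal.axioms(1)[OF power_ideal]])

lemma C_mult: "p \<in> up K \<Longrightarrow> q \<in> up K \<Longrightarrow> p \<otimes>\<^bsub>C\<^esub> q = (\<lambda>n. \<Oplus>\<^bsub>K\<^esub>i\<in>{..n}. p i \<otimes>\<^bsub>K\<^esub> q (n - i))"
  and C_add: "p \<in> up K \<Longrightarrow> q \<in> up K \<Longrightarrow> p \<oplus>\<^bsub>C\<^esub> q = (\<lambda>n. p n \<oplus>\<^bsub>K\<^esub> q n)"
  and C_one: "\<one>\<^bsub>C\<^esub> = (\<lambda>n. if n = 0 then \<one>\<^bsub>K\<^esub> else \<zero>\<^bsub>K\<^esub>)"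
  and C_zero: "\<zero>\<^bsub>C\<^esub> = (\<lambda>n. \<zero>\<^bsub>K\<^esub>)"
  by (simp_all add: rees_algebra_def UP_def)

lemma C_eq: "C = U\<lparr>carrier := carrier C\<rparr>"
  by (simp add: rees_algebra_def)

text \<open>Over an infinite index set the sum takes its default value zero, which lies in every
  power.\<close>

lemma power_finsum:
  assumes "\<And>i. i \<in> S \<Longrightarrow> p i \<in> Lp n"
  shows "(\<Oplus>\<^bsub>K\<^esub>i\<in>S. p i) \<in> Lp n"
proof -
  interpret I: ideal "Lp n" K
    by (rule power_ideal)
  show ?thesis
    using assms
  proof (induction S rule: infinite_finite_induct)
    case (insert i S)
    then show ?case
      by (subst K.finsum_insert) (auto intro: I.a_closed I.a_Hcarr)
  qed auto
qed

sublocale UP: UP_cring K U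
  by unfold_locales simp

text \<open>The condition on coefficients cuts out a subring of the polynomial ring: a coefficient
  of a product is a sum of elements of \<open>Lp i\<close> times \<open>Lp (n - i)\<close>, which is
  contained in \<open>Lp n\<close>.\<close>

sublocale C: cring C
proof -
  have "subcring (carrier C) U"
  proof (intro UP.subcringI' UP.subringI)
    show "carrier C \<subseteq> carrier U"
      by (simp_all add: carrier_iff_coeff subset_iff)
    show "\<one>\<^bsub>U\<^esub> \<in> carrier C"
      by (simp add: carrier_iff_coeff power_zero ideals_set_simps)
    fix p assume p: "p \<in> carrier C"
    then have pU: "p \<in> carrier U" and pn: "\<And>n. coeff U p n \<in> Lp n"
      by (simp_all add: carrier_iff_coeff subset_iff)
    show "\<ominus>\<^bsub>U\<^esub> p \<in> carrier C"
      using pU pn additive_subgroup.a_inv_closed[OF ideal.axioms(1)[OF power_ideal]]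
      by (simp_all add: carrier_iff_coeff subset_iff)
    fix q assume q: "q \<in> carrier C"
    then have qU: "q \<in> carrier U" and qn: "\<And>n. coeff U q n \<in> Lp n"
      by (simp_all add: carrier_iff_coeff subset_iff)
    show "p \<oplus>\<^bsub>U\<^esub> q \<in> carrier C"
      using pU pn qU qn additive_subgroup.a_closed[OF ideal.axioms(1)[OF power_ideal]]
      by (simp_all add: carrier_iff_coeff subset_iff)
    have "coeff U p i \<otimes>\<^bsub>K\<^esub> coeff U q (n - i) \<in> Lp n" if "i \<le> n" for n i
      using power_mult[OF pn[of i] qn[of "n - i"]] that by simp
    then show "p \<otimes>\<^bsub>U\<^esub> q \<in> carrier C"
      using pU qU by (auto simp: carrier_iff_coeff intro!: power_finsum)
  qed
  then have "cring (U\<lparr>carrier := carrier C\<rparr>)"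
    using UP.subcring_iff[of "carrier C"] subcringE(1) by blast
  then show "cring C"
    using C_eq by simp
qed

lemma monom_closed:
  assumes "a \<in> Lp n"
  shows "monom U a n \<in> carrier C"
proof -
  have "a \<in> carrier K"
    using assms by (rule power_carrier)
  then show ?thesis
    using assms by (simp add: carrier_iff_coeff power_zero)
qed

lemma const_closed: "a \<in> carrier K \<Longrightarrow> monom U a 0 \<in> carrier C"
  by (rule monom_closed) (simp add: ideals_set_simps)

lemma C_ops:
  "monoid.mult C = monoid.mult U" "ring.add C = ring.add U" "\<one>\<^bsub>C\<^esub> = \<one>\<^bsub>U\<^esub>" "\<zero>\<^bsub>C\<^esub> = \<zero>\<^bsub>U\<^esub>"
  by (simp_all add: rees_algebra_def)

lemma const_hom: "(\<lambda>a. monom U a 0) \<in> ring_hom K C"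
proof (rule ring_hom_memI)
  fix a b assume ab: "a \<in> carrier K" "b \<in> carrier K"
  show "monom U (a \<otimes>\<^bsub>K\<^esub> b) 0 = monom U a 0 \<otimes>\<^bsub>C\<^esub> monom U b 0"
    using UP.monom_mult[OF ab, of 0 0] by (simp add: C_ops)
  show "monom U (a \<oplus>\<^bsub>K\<^esub> b) 0 = monom U a 0 \<oplus>\<^bsub>C\<^esub> monom U b 0"
    using UP.monom_add[OF ab] by (simp add: C_ops)
qed (simp_all add: const_closed C_ops)

lemma const_mult_apply:
  assumes "a \<in> carrier K" "p \<in> carrier C"
  shows "(monom U a 0 \<otimes>\<^bsub>C\<^esub> p) n = a \<otimes>\<^bsub>K\<^esub> p n"
proof -
  have "p \<in> carrier U" and "p \<in> up K"
    using assms by (simp_all add: carrier_iff_coeff carrier_U)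
  then have "(a \<odot>\<^bsub>U\<^esub> p) n = a \<otimes>\<^bsub>K\<^esub> p n"
    using assms UP.coeff_smult[of a p n] UP.UP_smult_closed[of a p]
    by (simp add: coeff_eq carrier_U del: UP.coeff_smult)
  then show ?thesis
    using assms \<open>p \<in> carrier U\<close> by (simp add: C_ops UP.monom_mult_is_smult)
qed

text \<open>Sending \<open>x\<close> to \<open>x u\<close> is linear, and it lands in the Rees
  algebra because the first power of \<open>L\<close> is \<open>L\<close> itself.\<close>

sublocale sym: symmetric_algebra_lift K "ideal_module K L" C "\<lambda>a. monom U a 0" "\<lambda>x. monom U x 1"
proof -
  interpret module K "ideal_module K L"
    by (rule module_ideal_module)
  show "symmetric_algebra_lift K (ideal_module K L) C (\<lambda>a. monom U a 0) (\<lambda>x. monom U x 1)"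
  proof (unfold_locales)
    show "(\<lambda>a. monom U a 0) \<in> ring_hom K C"
      by (rule const_hom)
    fix x assume "x \<in> carrier (ideal_module K L)"
    then have x: "x \<in> L" "x \<in> carrier K"
      by (auto simp: L.a_Hcarr)
    then show "monom U x 1 \<in> carrier C"
      by (intro monom_closed) (simp only: One_nat_def power_1)
    show "monom U (a \<odot>\<^bsub>ideal_module K L\<^esub> x) 1 = monom U a 0 \<otimes>\<^bsub>C\<^esub> monom U x 1"
      if "a \<in> carrier K" for a
      using UP.monom_mult[OF that x(2), of 0 1] by (simp add: C_ops)
    fix y assume "y \<in> carrier (ideal_module K L)"
    then show "monom U (x \<oplus>\<^bsub>ideal_module K L\<^esub> y) 1 = monom U x 1 \<oplus>\<^bsub>C\<^esub> monom U y 1"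
      using x by (simp add: C_ops L.a_Hcarr)
  qed
qed

lemma sym_to_rees_hom: "sym_to_rees K L \<in> ring_hom (sym_algebra K (ideal_module K L)) C"
  unfolding sym_to_rees_def by (rule sym.lift_hom)

lemma sym_to_rees_const:
  "a \<in> carrier K \<Longrightarrow> sym_to_rees K L (a \<odot>\<^bsub>sym.S\<^esub> \<one>\<^bsub>sym.S\<^esub>) = monom U a 0"
  unfolding sym_to_rees_def by (rule sym.lift_const)

lemma sym_to_rees_gen: "x \<in> L \<Longrightarrow> sym_to_rees K L (sym_gen K (ideal_module K L) x) = monom U x 1"
  unfolding sym_to_rees_def by (rule sym.lift_gen) simp

end

section \<open>The embedded Aluffi algebra\<close>

lemma regular_elementD:
  assumes "regular_element R a"
  shows "a \<in> carrier R"
    and "x \<in> carrier R \<Longrightarrow> a \<otimes>\<^bsub>R\<^esub> x = \<zero>\<^bsub>R\<^esub> \<Longrightarrow> x = \<zero>\<^bsub>R\<^esub>"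
  using assms unfolding regular_element_def by blast+

text \<open>Regularity cancels one factor \<open>a\<close> at a time.\<close>

lemma (in cring) regular_element_pow:
  assumes "regular_element R a"
  shows "regular_element R (a [^] (n::nat))"
proof (induction n)
  case 0
  show ?case
    by (simp add: regular_element_def)
next
  case (Suc n)
  have a: "a \<in> carrier R"
    using assms by (rule regular_elementD)
  have "x = \<zero>" if x: "x \<in> carrier R" and zero: "a [^] Suc n \<otimes> x = \<zero>" for x
  proof -
    have "a [^] n \<otimes> (a \<otimes> x) = \<zero>"
      using zero a x by (simp add: m_assoc)
    then have "a \<otimes> x = \<zero>"
      by (rule regular_elementD(2)[OF Suc m_closed[OF a x]])
    then show ?thesis
      by (rule regular_elementD(2)[OF assms x])
  qed
  then show ?case
    using a unfolding regular_element_def by blast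
qed

lemma zero_quot: "\<zero>\<^bsub>P Quot N\<^esub> = N"
  by (simp add: FactRing_def)

locale aluffi = R: cring R + J: ideal J R + I: ideal I R
  for R :: "('a, 'm) ring_scheme" and J I :: "'a set" +
  assumes J_subset_I: "J \<subseteq> I"
begin

abbreviation Rq where "Rq \<equiv> R Quot J"
abbreviation Iq where "Iq \<equiv> quot_ideal R J I"
abbreviation red where "red \<equiv> \<lambda>x. J +>\<^bsub>R\<^esub> x"

sublocale Rq: cring Rq
  by (rule J.quotient_is_cring[OF R.is_cring])

sublocale red: ring_hom_cring R Rq red
  by unfold_locales (rule J.rcos_ring_hom)

lemma red_eq_zero_iff: "x \<in> carrier R \<Longrightarrow> red x = \<zero>\<^bsub>Rq\<^esub> \<longleftrightarrow> x \<in> J"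
proof -
  assume x: "x \<in> carrier R"
  show ?thesis
    using J.quot_coset_eq_zero[of x] J.a_rcos_self[OF x] unfolding zero_quot by metis
qed

sublocale A: rees R I
  by (intro rees.intro R.is_cring I.ideal_axioms)

sublocale Q: rees Rq Iq
proof (intro rees.intro Rq.is_cring)
  show "ideal Iq Rq"
    unfolding quot_ideal_def by (rule R.ring_ideal_imp_quot_ideal[OF J.ideal_axioms I.ideal_axioms])
qed

section \<open>The commuting square of symmetric and Rees algebras\<close>

abbreviation S where "S \<equiv> sym_algebra R (ideal_module R I)"
abbreviation B where "B \<equiv> sym_algebra Rq (ideal_module Rq Iq)"
abbreviation f where "f \<equiv> sym_sub_to_quot R J I"
abbreviation g where "g \<equiv> sym_to_rees R I"
abbreviation h where "h \<equiv> sym_to_rees Rq Iq"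
abbreviation \<rho> where "\<rho> \<equiv> \<lambda>p t. red (p t)"
abbreviation genq where "genq \<equiv> sym_gen Rq (ideal_module Rq Iq)"

lemma red_Iq: "x \<in> I \<Longrightarrow> red x \<in> Iq"
  by (simp add: quot_ideal_def)

sublocale f: symmetric_algebra_lift R "ideal_module R I" B
  "\<lambda>r. red r \<odot>\<^bsub>B\<^esub> \<one>\<^bsub>B\<^esub>" "\<lambda>x. genq (red x)"
proof unfold_locales
  show "(\<lambda>r. red r \<odot>\<^bsub>B\<^esub> \<one>\<^bsub>B\<^esub>) \<in> ring_hom R B"
    using ring_hom_trans[OF red.homh Q.sym.const_hom] by (simp add: o_def)
  fix x assume "x \<in> carrier (ideal_module R I)"
  then have x: "x \<in> I" "x \<in> carrier R"
    by (auto simp: I.a_Hcarr)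
  then show "genq (red x) \<in> carrier B"
    by (intro Q.sym.gen_closed) (simp add: red_Iq)
  show "genq (red (a \<odot>\<^bsub>ideal_module R I\<^esub> x)) = (red a \<odot>\<^bsub>B\<^esub> \<one>\<^bsub>B\<^esub>) \<otimes>\<^bsub>B\<^esub> genq (red x)"
    if a: "a \<in> carrier R" for a
    using Q.sym.gen_smult[of "red a" "red x"] a x by (simp add: red_Iq)
  fix y assume "y \<in> carrier (ideal_module R I)"
  then have y: "y \<in> I" "y \<in> carrier R"
    by (auto simp: I.a_Hcarr)
  then show "genq (red (x \<oplus>\<^bsub>ideal_module R I\<^esub> y)) = genq (red x) \<oplus>\<^bsub>B\<^esub> genq (red y)"
    using Q.sym.gen_add[of "red x" "red y"] x by (simp add: red_Iq)
qed

lemma f_eq: "f = sym_lift R B (\<lambda>r. red r \<odot>\<^bsub>B\<^esub> \<one>\<^bsub>B\<^esub>) (\<lambda>x. genq (red x))"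
  by (simp add: sym_sub_to_quot_def sym_quot_def)

lemma f_hom: "f \<in> ring_hom S B"
  unfolding f_eq by (rule f.lift_hom)

lemma f_const: "a \<in> carrier R \<Longrightarrow> f (a \<odot>\<^bsub>S\<^esub> \<one>\<^bsub>S\<^esub>) = red a \<odot>\<^bsub>B\<^esub> \<one>\<^bsub>B\<^esub>"
  unfolding f_eq by (rule f.lift_const)

lemma f_gen: "x \<in> I \<Longrightarrow> f (sym_gen R (ideal_module R I) x) = genq (red x)"
  unfolding f_eq by (rule f.lift_gen) simp

text \<open>Constants and generators lift along \<open>R\<close> to \<open>R/J\<close> and
  \<open>I\<close> to \<open>I/J\<close>, and images of a homomorphism are closed under sums and
  products. Every first tensor factor can therefore be moved to the second.\<close>

lemma f_surj: "b \<in> carrier B \<Longrightarrow> \<exists>s\<in>carrier S. b = f s"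
proof (induction b rule: Q.sym.S_induct)
  case (const a)
  then obtain r where "r \<in> carrier R" "a = red r"
    unfolding carrier_quot by (elim imageE)
  then show ?case
    using f_const ring_hom_closed[OF A.sym.const_hom] by (intro bexI[of _ "r \<odot>\<^bsub>S\<^esub> \<one>\<^bsub>S\<^esub>"]) simp_all
next
  case (gen x)
  then obtain r where "r \<in> I" "x = red r"
    unfolding ideal_module_simps quot_ideal_def by (elim imageE)
  then show ?case
    using f_gen A.sym.gen_closed
    by (intro bexI[of _ "sym_gen R (ideal_module R I) r"]) simp_all
next
  case (add Y Z)
  then show ?case
    using ring_hom_add[OF f_hom] A.sym.S.a_closed by metis
next
  case (mult Y Z)
  then show ?case
    using ring_hom_mult[OF f_hom] A.sym.S.m_closed by metis
qed

text \<open>Reduction respects sums and products, hence products of ideals. This is why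
  coefficientwise reduction ends in the Rees algebra of \<open>I/J\<close>.\<close>

lemma red_power: "x \<in> A.Lp n \<Longrightarrow> red x \<in> Q.Lp n"
proof (induction n arbitrary: x)
  case 0
  then show ?case
    by (simp add: A.ideals_set_simps Q.ideals_set_simps)
next
  case (Suc n)
  have *: "ideal (A.Lp n) R"
    by (rule A.power_ideal)
  from Suc.prems have "x \<in> ideal_prod R (A.Lp n) I"
    unfolding A.power_Suc .
  \<comment> \<open>Membership in the ring is carried through the induction because additivity of
    \<open>red\<close> requires it.\<close>
  then have "x \<in> carrier R \<and> red x \<in> ideal_prod Rq (Q.Lp n) Iq"
  proof (induction rule: ideal_prod.induct)
    case (prod i j)
    then have "i \<in> carrier R" "j \<in> carrier R"
      by (auto simp: A.power_carrier I.a_Hcarr)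
    then show ?case
      using ideal_prod.prod[of "red i" "Q.Lp n" "red j" Iq Rq] Suc.IH prod by (simp add: red_Iq)
  next
    case (sum x y)
    then show ?case
      using ideal_prod.sum[of "red x" Rq "Q.Lp n" Iq "red y"] by simp
  qed
  then show ?case
    unfolding Q.power_Suc by simp
qed

lemma \<rho>_hom: "\<rho> \<in> ring_hom A.C Q.C"
proof (rule ring_hom_memI)
  \<comment> \<open>Reduction maps zero to zero, so a degree bound is preserved.\<close>
  have \<rho>_up: "\<rho> p \<in> up Rq" if p: "p \<in> up R" for p
  proof
    obtain n where "bound \<zero>\<^bsub>R\<^esub> n p"
      using R.bound_upD[OF p] by blast
    then have "bound \<zero>\<^bsub>Rq\<^esub> n (\<rho> p)"
      by (auto simp: bound_def)
    then show "\<exists>n. bound \<zero>\<^bsub>Rq\<^esub> n (\<rho> p)" ..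
  qed (use p in auto)
  show "\<rho> \<one>\<^bsub>A.C\<^esub> = \<one>\<^bsub>Q.C\<^esub>"
    by (rule ext) (simp add: A.C_one Q.C_one)
  fix p assume "p \<in> carrier A.C"
  then have p: "p \<in> up R" "\<And>n. p n \<in> carrier R" "\<And>n. p n \<in> A.Lp n"
    by (auto simp: A.carrier_iff)
  then show "\<rho> p \<in> carrier Q.C"
    by (simp add: Q.carrier_iff red_power \<rho>_up)
  fix q assume "q \<in> carrier A.C"
  then have q: "q \<in> up R" "\<And>n. q n \<in> carrier R"
    by (auto simp: A.carrier_iff)
  show "\<rho> (p \<oplus>\<^bsub>A.C\<^esub> q) = \<rho> p \<oplus>\<^bsub>Q.C\<^esub> \<rho> q"
    using p q by (simp add: A.C_add Q.C_add \<rho>_up)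
  have "red (\<Oplus>\<^bsub>R\<^esub>i\<in>{..n}. p i \<otimes>\<^bsub>R\<^esub> q (n - i))
      = (\<Oplus>\<^bsub>Rq\<^esub>i\<in>{..n}. red (p i) \<otimes>\<^bsub>Rq\<^esub> red (q (n - i)))" for n
    using p q by (subst red.hom_finsum) (auto simp: o_def)
  then show "\<rho> (p \<otimes>\<^bsub>A.C\<^esub> q) = \<rho> p \<otimes>\<^bsub>Q.C\<^esub> \<rho> q"
    using p q by (simp add: A.C_mult Q.C_mult \<rho>_up)
qed

lemma \<rho>_monom: "a \<in> carrier R \<Longrightarrow> \<rho> (monom (UP R) a n) = monom (UP Rq) (red a) n"
  by (rule ext) (simp add: A.monom_apply Q.monom_apply)

text \<open>Both composites are ring homomorphisms out of a symmetric algebra, so it is enough to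
  compare constants and generators. This is the compatibility that makes the natural map well
  defined on the tensor product.\<close>

lemma square: "s \<in> carrier S \<Longrightarrow> h (f s) = \<rho> (g s)"
proof -
  assume s: "s \<in> carrier S"
  have "(h \<circ> f) s = (\<rho> \<circ> g) s"
  proof (rule A.sym.ring_hom_eqI[OF _ _ _ _ s])
    show "h \<circ> f \<in> ring_hom S Q.C"
      by (rule ring_hom_trans[OF f_hom Q.sym_to_rees_hom])
    show "\<rho> \<circ> g \<in> ring_hom S Q.C"
      by (rule ring_hom_trans[OF A.sym_to_rees_hom \<rho>_hom])
    show "(h \<circ> f) (a \<odot>\<^bsub>S\<^esub> \<one>\<^bsub>S\<^esub>) = (\<rho> \<circ> g) (a \<odot>\<^bsub>S\<^esub> \<one>\<^bsub>S\<^esub>)" if "a \<in> carrier R" for a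
      unfolding o_apply f_const[OF that] A.sym_to_rees_const[OF that] \<rho>_monom[OF that]
      by (rule Q.sym_to_rees_const) (rule red.hom_closed[OF that])
    show "(h \<circ> f) (sym_gen R (ideal_module R I) x) = (\<rho> \<circ> g) (sym_gen R (ideal_module R I) x)"
      if "x \<in> carrier (ideal_module R I)" for x
    proof -
      have x: "x \<in> I" "x \<in> carrier R"
        using that by (auto simp: I.a_Hcarr)
      show ?thesis
        unfolding o_apply f_gen[OF x(1)] A.sym_to_rees_gen[OF x(1)] \<rho>_monom[OF x(2)]
        by (rule Q.sym_to_rees_gen) (rule red_Iq[OF x(1)])
    qed
  qed
  then show ?thesis
    by simp
qed

sublocale T: tensor_product_lift B A.C S f g Q.C h \<rho>
  by unfold_locales
    (auto intro: ring_hom_closed[OF f_hom] ring_hom_closed[OF A.sym_to_rees_hom]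
      Q.sym_to_rees_hom \<rho>_hom square)

abbreviation \<Phi> where "\<Phi> \<equiv> aluffi_to_rees R J I"
abbreviation Al where "Al \<equiv> aluffi_algebra R J I"

lemma \<Phi>_eq: "\<Phi> = tensor_lift Q.C h \<rho>"
  by (simp add: aluffi_to_rees_def rees_quot_def)

lemma Al_simps:
  "carrier Al = carrier T.T"
  "\<zero>\<^bsub>Al\<^esub> = \<zero>\<^bsub>T.T\<^esub>"
  "a \<odot>\<^bsub>Al\<^esub> Y = T.t (a \<odot>\<^bsub>B\<^esub> \<one>\<^bsub>B\<^esub>) \<one>\<^bsub>A.C\<^esub> \<otimes>\<^bsub>T.T\<^esub> Y"
  by (simp_all add: aluffi_algebra_def Let_def sym_sub_def sym_quot_def ring.defs module.defs)

section \<open>Normal form of elements of the Aluffi algebra\<close>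

lemma pure_eq_one_tensor:
  assumes "s \<in> carrier S" "p \<in> carrier A.C"
  shows "T.t (f s) p = T.t \<one>\<^bsub>B\<^esub> (g s \<otimes>\<^bsub>A.C\<^esub> p)"
  using T.t_balanced[of "\<one>\<^bsub>B\<^esub>" s p] assms by (simp add: T.f_closed)

text \<open>After all first factors have been moved across, sums of tensors merge, because they
  share the first factor one.\<close>

lemma T_one_tensor: "Y \<in> carrier T.T \<Longrightarrow> \<exists>p\<in>carrier A.C. Y = T.t \<one>\<^bsub>B\<^esub> p"
proof (induction Y rule: T.T_induct)
  case (pure b p)
  then obtain s where "s \<in> carrier S" "b = f s"
    using f_surj by blast
  then show ?case
    using pure pure_eq_one_tensor by (intro bexI[of _ "g s \<otimes>\<^bsub>A.C\<^esub> p"]) (simp_all add: T.g_closed)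
next
  case (add Y Z)
  then obtain p q where "p \<in> carrier A.C" "Y = T.t \<one>\<^bsub>B\<^esub> p" "q \<in> carrier A.C" "Z = T.t \<one>\<^bsub>B\<^esub> q"
    by blast
  then show ?case
    by (intro bexI[of _ "p \<oplus>\<^bsub>A.C\<^esub> q"]) (simp_all add: T.t_add_right)
next
  case (minus Y)
  then obtain p where "p \<in> carrier A.C" "Y = T.t \<one>\<^bsub>B\<^esub> p"
    by blast
  then show ?case
    by (intro bexI[of _ "\<ominus>\<^bsub>A.C\<^esub> p"]) (simp_all add: T.t_minus_right)
qed

text \<open>Source of all vanishing below: balancing identifies this tensor with
  \<open>f s \<otimes> p\<close>, whose first factor is zero.\<close>

lemma one_tensor_eq_zero:
  assumes "s \<in> carrier S" "f s = \<zero>\<^bsub>B\<^esub>" "p \<in> carrier A.C"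
  shows "T.t \<one>\<^bsub>B\<^esub> (g s \<otimes>\<^bsub>A.C\<^esub> p) = \<zero>\<^bsub>T.T\<^esub>"
  using pure_eq_one_tensor[OF assms(1,3)] assms by (simp add: T.t_zero_left)

text \<open>The action is defined through the first factor, but the class of \<open>r\<close> there
  is the image under \<open>f\<close> of the constant \<open>r\<close>, so it can be moved to the
  Rees factor.\<close>

lemma smult_one_tensor:
  assumes "r \<in> carrier R" "p \<in> carrier A.C"
  shows "red r \<odot>\<^bsub>Al\<^esub> T.t \<one>\<^bsub>B\<^esub> p = T.t \<one>\<^bsub>B\<^esub> (monom (UP R) r 0 \<otimes>\<^bsub>A.C\<^esub> p)"
proof -
  let ?s = "r \<odot>\<^bsub>S\<^esub> \<one>\<^bsub>S\<^esub>"
  have s: "?s \<in> carrier S" "f ?s = red r \<odot>\<^bsub>B\<^esub> \<one>\<^bsub>B\<^esub>" "g ?s = monom (UP R) r 0"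
    by (rule ring_hom_closed[OF A.sym.const_hom assms(1)] f_const[OF assms(1)]
        A.sym_to_rees_const[OF assms(1)])+
  have "red r \<odot>\<^bsub>Al\<^esub> T.t \<one>\<^bsub>B\<^esub> p = T.t (f ?s) \<one>\<^bsub>A.C\<^esub> \<otimes>\<^bsub>T.T\<^esub> T.t \<one>\<^bsub>B\<^esub> p"
    unfolding Al_simps s(2) by (rule refl)
  also have "\<dots> = T.t (f ?s) p"
    using s(1) assms by (subst T.t_mult) (simp_all add: T.f_closed)
  also have "\<dots> = T.t \<one>\<^bsub>B\<^esub> (monom (UP R) r 0 \<otimes>\<^bsub>A.C\<^esub> p)"
    unfolding pure_eq_one_tensor[OF s(1) assms(2)] s(3) by (rule refl)
  finally show ?thesis .
qed

lemma \<Phi>_one_tensor: "p \<in> carrier A.C \<Longrightarrow> \<Phi> (T.t \<one>\<^bsub>B\<^esub> p) = \<rho> p"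
proof -
  assume p: "p \<in> carrier A.C"
  have "\<Phi> (T.t \<one>\<^bsub>B\<^esub> p) = h \<one>\<^bsub>B\<^esub> \<otimes>\<^bsub>Q.C\<^esub> \<rho> p"
    unfolding \<Phi>_eq by (rule T.lift_pure[OF Q.sym.S.one_closed p])
  also have "\<dots> = \<rho> p"
    unfolding T.h.hom_one by (rule Q.C.l_one[OF T.k.hom_closed[OF p]])
  finally show ?thesis .
qed

text \<open>Linearity over \<open>R/J\<close>, stated for single coefficients because regularity
  will be applied to them one by one.\<close>

lemma \<Phi>_smult:
  assumes "c \<in> carrier Rq" "Y \<in> carrier T.T"
  shows "\<Phi> (c \<odot>\<^bsub>Al\<^esub> Y) n = c \<otimes>\<^bsub>Rq\<^esub> \<Phi> Y n"
proof -
  obtain r where r: "r \<in> carrier R" "c = red r"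
    using assms(1) unfolding carrier_quot by (elim imageE)
  obtain p where p: "p \<in> carrier A.C" "Y = T.t \<one>\<^bsub>B\<^esub> p"
    using T_one_tensor[OF assms(2)] by blast
  have "\<Phi> (c \<odot>\<^bsub>Al\<^esub> Y) n = red ((monom (UP R) r 0 \<otimes>\<^bsub>A.C\<^esub> p) n)"
    unfolding r(2) p(2) smult_one_tensor[OF r(1) p(1)] using r p
    by (subst \<Phi>_one_tensor) (simp_all add: A.const_closed)
  also have "\<dots> = c \<otimes>\<^bsub>Rq\<^esub> \<Phi> Y n"
    using r p by (simp add: A.const_mult_apply \<Phi>_one_tensor A.carrier_iff mem_upD)
  finally show ?thesis .
qed

lemma torsion_subset_kernel: "torsion Rq Al \<subseteq> a_kernel Al (rees_quot R J I) \<Phi>"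
proof
  fix Y assume "Y \<in> torsion Rq Al"
  then obtain c where Y: "Y \<in> carrier T.T" and c: "regular_element Rq c" and zero: "c \<odot>\<^bsub>Al\<^esub> Y = \<zero>\<^bsub>T.T\<^esub>"
    by (auto simp: torsion_def Al_simps(1,2))
  have "\<Phi> Y \<in> carrier Q.C"
    unfolding \<Phi>_eq by (rule ring_hom_closed[OF T.lift_hom Y])
  then have closed: "\<Phi> Y n \<in> carrier Rq" for n
    by (auto simp: Q.carrier_iff)
  have "\<Phi> \<zero>\<^bsub>T.T\<^esub> = \<zero>\<^bsub>Q.C\<^esub>"
    unfolding \<Phi>_eq by (rule ring_hom_zero[OF T.lift_hom T.T.ring_axioms Q.C.ring_axioms])
  then have "c \<otimes>\<^bsub>Rq\<^esub> \<Phi> Y n = \<zero>\<^bsub>Rq\<^esub>" for n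
    using \<Phi>_smult[OF regular_elementD(1)[OF c] Y, of n] zero by (simp add: Q.C_zero)
  then have "\<Phi> Y n = \<zero>\<^bsub>Rq\<^esub>" for n
    by (rule regular_elementD(2)[OF c closed])
  then have "\<Phi> Y = \<zero>\<^bsub>Q.C\<^esub>"
    by (auto simp: Q.C_zero)
  then show "Y \<in> a_kernel Al (rees_quot R J I) \<Phi>"
    using Y by (simp add: a_kernel_def' Al_simps(1) rees_quot_def)
qed

text \<open>One factor is split off that the symmetric algebra of \<open>I/J\<close> kills: the
  generator at \<open>y\<close> in positive degree, the scalar \<open>y\<close> in degree zero. The
  remaining factor must still belong to the Rees algebra, which is what the bound on
  \<open>k\<close> ensures.\<close>

lemma one_tensor_monom_eq_zero:
  assumes a: "a \<in> I" and y: "y \<in> J" and "k \<le> Suc n"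
  shows "T.t \<one>\<^bsub>B\<^esub> (monom (UP R) (y \<otimes>\<^bsub>R\<^esub> a [^]\<^bsub>R\<^esub> n) k) = \<zero>\<^bsub>T.T\<^esub>"
proof -
  have aR: "a [^]\<^bsub>R\<^esub> n \<in> carrier R" and yR: "y \<in> carrier R" and yI: "y \<in> I"
    using a y J_subset_I by (auto simp: I.a_Hcarr J.a_Hcarr)
  have red_y: "red y = \<zero>\<^bsub>Rq\<^esub>"
    using y yR by (simp add: red_eq_zero_iff)
  have const0: "\<zero>\<^bsub>Rq\<^esub> \<odot>\<^bsub>B\<^esub> \<one>\<^bsub>B\<^esub> = \<zero>\<^bsub>B\<^esub>"
    using ring_hom_zero[OF Q.sym.const_hom Rq.ring_axioms Q.sym.S.ring_axioms] .
  show ?thesis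
  proof (cases k)
    case 0
    let ?s = "y \<odot>\<^bsub>S\<^esub> \<one>\<^bsub>S\<^esub>"
    have "?s \<in> carrier S"
      by (rule ring_hom_closed[OF A.sym.const_hom yR])
    moreover have "f ?s = \<zero>\<^bsub>B\<^esub>"
      unfolding f_const[OF yR] red_y by (rule const0)
    moreover have "monom (UP R) (y \<otimes>\<^bsub>R\<^esub> a [^]\<^bsub>R\<^esub> n) k = g ?s \<otimes>\<^bsub>A.C\<^esub> monom (UP R) (a [^]\<^bsub>R\<^esub> n) 0"
      unfolding A.sym_to_rees_const[OF yR] 0 using A.UP.monom_mult[OF yR aR, of 0 0]
      by (simp only: A.C_ops add_0)
    ultimately show ?thesis
      using one_tensor_eq_zero A.const_closed[OF aR] by simp
  next
    case (Suc m)
    let ?s = "sym_gen R (ideal_module R I) y"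
    have "?s \<in> carrier S"
      by (rule A.sym.gen_closed) (simp add: yI)
    moreover have "f ?s = \<zero>\<^bsub>B\<^esub>"
    proof -
      \<comment> \<open>Writing zero as a multiple of itself lets \<open>gen_smult\<close> show that
        the generator at zero vanishes.\<close>
      have "genq \<zero>\<^bsub>Rq\<^esub> = genq (\<zero>\<^bsub>Rq\<^esub> \<otimes>\<^bsub>Rq\<^esub> \<zero>\<^bsub>Rq\<^esub>)"
        by simp
      also have "\<dots> = (\<zero>\<^bsub>Rq\<^esub> \<odot>\<^bsub>B\<^esub> \<one>\<^bsub>B\<^esub>) \<otimes>\<^bsub>B\<^esub> genq \<zero>\<^bsub>Rq\<^esub>"
        using Q.sym.gen_smult[of "\<zero>\<^bsub>Rq\<^esub>" "\<zero>\<^bsub>Rq\<^esub>"] Q.L.zero_closed by simp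
      also have "\<dots> = \<zero>\<^bsub>B\<^esub>"
        unfolding const0 using Q.L.zero_closed by (intro Q.sym.S.l_null Q.sym.gen_closed) simp
      finally show ?thesis
        unfolding f_gen[OF yI] red_y .
    qed
    \<comment> \<open>Removing \<open>y u\<close> lowers the degree from \<open>k\<close> to
      \<open>m\<close>, with \<open>m \<le> n\<close>; hence \<open>a^n\<close> may serve as the
      coefficient of \<open>u^m\<close>.\<close>
    moreover have "a [^]\<^bsub>R\<^esub> n \<in> A.Lp m"
      using A.pow_in_power[OF a, of n] A.power_antimono[of m n] assms(3) Suc by auto
    moreover have "monom (UP R) (y \<otimes>\<^bsub>R\<^esub> a [^]\<^bsub>R\<^esub> n) k = g ?s \<otimes>\<^bsub>A.C\<^esub> monom (UP R) (a [^]\<^bsub>R\<^esub> n) m"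
      unfolding A.sym_to_rees_gen[OF yI] Suc using A.UP.monom_mult[OF yR aR, of 1 m]
      by (simp only: A.C_ops plus_1_eq_Suc)
    ultimately show ?thesis
      using one_tensor_eq_zero A.monom_closed by simp
  qed
qed

text \<open>Monomials are removed from the top by induction on the truncation index
  \<open>k\<close>. The highest possible degree is \<open>k - 1\<close>, at most
  \<open>n + 1\<close>, which is the last degree that \<open>one_tensor_monom_eq_zero\<close>
  covers.\<close>

lemma one_tensor_truncated_eq_zero:
  assumes a: "a \<in> I" and "k \<le> Suc (Suc n)" and "q \<in> carrier A.C"
    and "\<And>t. \<exists>y\<in>J. q t = y \<otimes>\<^bsub>R\<^esub> a [^]\<^bsub>R\<^esub> n" and "\<And>t. t \<ge> k \<Longrightarrow> q t = \<zero>\<^bsub>R\<^esub>"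
  shows "T.t \<one>\<^bsub>B\<^esub> q = \<zero>\<^bsub>T.T\<^esub>"
  using assms(2-)
proof (induction k arbitrary: q)
  case 0
  then have "q = \<zero>\<^bsub>A.C\<^esub>"
    by (auto simp: A.C_zero)
  then show ?case
    by (simp add: T.t_zero_right)
next
  case (Suc k)
  have q: "q \<in> up R" "\<And>t. q t \<in> A.Lp t" "\<And>t. q t \<in> carrier R"
    using Suc.prems(2) by (auto simp: A.carrier_iff)
  define q' where "q' = q(k := \<zero>\<^bsub>R\<^esub>)"
  have "bound \<zero>\<^bsub>R\<^esub> k q'"
    using Suc.prems(4) by (auto simp: bound_def q'_def)
  then have q'_up: "q' \<in> up R"
    using q(3) by (intro mem_upI exI) (simp_all add: q'_def)
  then have q': "q' \<in> carrier A.C"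
    using q(2) by (simp add: A.carrier_iff q'_def A.power_zero)
  have mono: "monom (UP R) (q k) k \<in> carrier A.C"
    by (rule A.monom_closed[OF q(2)])
  have "q = q' \<oplus>\<^bsub>A.C\<^esub> monom (UP R) (q k) k"
    using q'_up mono q(3) by (auto simp: A.C_add A.carrier_iff A.monom_apply q'_def)
  then have "T.t \<one>\<^bsub>B\<^esub> q = T.t \<one>\<^bsub>B\<^esub> q' \<oplus>\<^bsub>T.T\<^esub> T.t \<one>\<^bsub>B\<^esub> (monom (UP R) (q k) k)"
    using q' mono by (simp flip: T.t_add_right)
  also have "T.t \<one>\<^bsub>B\<^esub> q' = \<zero>\<^bsub>T.T\<^esub>"
  proof (rule Suc.IH[OF _ q'])
    \<comment> \<open>The erased coefficient must keep the required form; zero does, with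
      \<open>y\<close> equal to zero in \<open>J\<close>.\<close>
    have "\<zero>\<^bsub>R\<^esub> = \<zero>\<^bsub>R\<^esub> \<otimes>\<^bsub>R\<^esub> a [^]\<^bsub>R\<^esub> n"
      using a by (simp add: I.a_Hcarr)
    then show "\<exists>y\<in>J. q' t = y \<otimes>\<^bsub>R\<^esub> a [^]\<^bsub>R\<^esub> n" for t
      using Suc.prems(3)[of t] J.zero_closed by (cases "t = k") (auto simp: q'_def)
  qed (use Suc.prems in \<open>auto simp: q'_def\<close>)
  also have "T.t \<one>\<^bsub>B\<^esub> (monom (UP R) (q k) k) = \<zero>\<^bsub>T.T\<^esub>"
  proof -
    obtain y where y: "y \<in> J" "q k = y \<otimes>\<^bsub>R\<^esub> a [^]\<^bsub>R\<^esub> n"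
      using Suc.prems(3) by blast
    show ?thesis
      unfolding y(2) by (rule one_tensor_monom_eq_zero[OF a y(1)]) (use Suc.prems(1) in simp)
  qed
  finally show ?case
    by simp
qed

text \<open>The annihilator is uniform over all degrees of \<open>p\<close>: it is the class of
  \<open>a^n\<close> with \<open>n\<close> a degree bound of \<open>p\<close>, and it is regular as
  a power of a regular element.\<close>

lemma kernel_subset_torsion:
  assumes a: "a \<in> I" and reg: "regular_element Rq (red a)"
  shows "a_kernel Al (rees_quot R J I) \<Phi> \<subseteq> torsion Rq Al"
proof
  fix Y assume "Y \<in> a_kernel Al (rees_quot R J I) \<Phi>"
  then have Y: "Y \<in> carrier T.T" and zero: "\<Phi> Y = \<zero>\<^bsub>Q.C\<^esub>"
    by (auto simp: a_kernel_def' Al_simps(1) rees_quot_def)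
  obtain p where p: "p \<in> carrier A.C" "Y = T.t \<one>\<^bsub>B\<^esub> p"
    using T_one_tensor[OF Y] by blast
  then have up: "p \<in> up R" "\<And>t. p t \<in> carrier R"
    by (auto simp: A.carrier_iff)
  have "red (p t) = \<zero>\<^bsub>Rq\<^esub>" for t
    using fun_cong[OF zero, of t] p by (simp add: \<Phi>_one_tensor Q.C_zero)
  then have pJ: "p t \<in> J" for t
    using up red_eq_zero_iff by blast
  obtain n where n: "bound \<zero>\<^bsub>R\<^esub> n p"
    using R.bound_upD[OF up(1)] by blast
  have aR: "a \<in> carrier R" "a [^]\<^bsub>R\<^esub> n \<in> carrier R"
    using a by (auto simp: I.a_Hcarr)
  let ?q = "monom (UP R) (a [^]\<^bsub>R\<^esub> n) 0 \<otimes>\<^bsub>A.C\<^esub> p"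
  have q: "?q t = p t \<otimes>\<^bsub>R\<^esub> a [^]\<^bsub>R\<^esub> n" for t
    unfolding A.const_mult_apply[OF aR(2) p(1)] by (rule R.m_comm[OF aR(2) up(2)])
  have "T.t \<one>\<^bsub>B\<^esub> ?q = \<zero>\<^bsub>T.T\<^esub>"
  \<comment> \<open>\<open>bound\<close> makes the coefficients vanish strictly above
    \<open>n\<close>, so the truncation index is \<open>Suc n\<close>, within the admissible
    \<open>Suc (Suc n)\<close>.\<close>
  proof (rule one_tensor_truncated_eq_zero[OF a, of "Suc n" n])
    show "?q \<in> carrier A.C"
      using aR p by (intro A.C.m_closed A.const_closed)
    show "\<exists>y\<in>J. ?q t = y \<otimes>\<^bsub>R\<^esub> a [^]\<^bsub>R\<^esub> n" for t
      using q pJ by blast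
    show "?q t = \<zero>\<^bsub>R\<^esub>" if "t \<ge> Suc n" for t
      using q[of t] bound.bound[OF n, of t] that aR by simp
  qed simp
  then have "red (a [^]\<^bsub>R\<^esub> n) \<odot>\<^bsub>Al\<^esub> Y = \<zero>\<^bsub>Al\<^esub>"
    unfolding p(2) smult_one_tensor[OF aR(2) p(1)] Al_simps(2) .
  moreover have "regular_element Rq (red (a [^]\<^bsub>R\<^esub> n))"
  proof -
    have "red (a [^]\<^bsub>R\<^esub> n) = red a [^]\<^bsub>Rq\<^esub> n"
      using aR(1) by (induction n) simp_all
    then show ?thesis
      using Rq.regular_element_pow[OF reg, of n] by simp
  qed
  ultimately show "Y \<in> torsion Rq Al"
    using Y unfolding torsion_def Al_simps(1) by blast
qed

end

theorem proposition2p5: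
  fixes R :: "('a, 'm) ring_scheme" and I J :: "'a set"
  assumes "cring R" and "noetherian_ring R"
    and "ideal J R" and "ideal I R"
    and "J \<subseteq> I" and "I \<subset> carrier R"
    and "\<exists>a \<in> quot_ideal R J I. regular_element (R Quot J) a"
  shows "torsion (R Quot J) (aluffi_algebra R J I)
       = a_kernel (aluffi_algebra R J I) (rees_quot R J I) (aluffi_to_rees R J I)"
proof -
  interpret aluffi R J I
    using assms by (intro aluffi.intro aluffi_axioms.intro)
  \<comment> \<open>A regular element of \<open>I/J\<close> is lifted to a representative in
    \<open>I\<close>, since the Rees algebra of \<open>I\<close> needs powers of an actual element
    of \<open>I\<close>.\<close>
  obtain a where "a \<in> I" "regular_element (R Quot J) (J +>\<^bsub>R\<^esub> a)"
    using assms(7) by (auto simp: quot_ideal_def)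
  then show ?thesis
    by (intro equalityI torsion_subset_kernel kernel_subset_torsion)
qed

end
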